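(* Let $\mathcal{A}$ be an abelian category, let $T\colon \mathcal{A}\to \mathsf{Ab}$ be a right exact functor to the category of abelian groups, and let $C$ be a chain complex in $\mathcal{A}$. Then for every $n\in\mathbb{Z}$ there is an isomorphism of abelian groups $$\mathsf{Y}_n(C)\colon \mathrm{Nat}\big(\mathrm{H}^n\mathrm{Hom}_{\mathcal{A}}(C,-),\,T\big)\xrightarrow{\ \cong\ }\mathrm{H}_n(TC),$$ natural in $C$ and in $T$.
   Context: Chain complexes are $\mathbb{Z}$-graded, $C=(\cdots\to C_{n+1}\xrightarrow{d_{n+1}}C_n\xrightarrow{d_n}C_{n-1}\to\cdots)$. $\mathrm{H}^n\mathrm{Hom}_{\mathcal{A}}(C,-)\colon\mathcal{A}\to\mathsf{Ab}$ is the functor sending $A$ to the $n$-th cohomology group of the cochain complex $\mathrm{Hom}_{\mathcal{A}}(C,A)$, with differentials $d_n^{*}\colon\mathrm{Hom}_{\mathcal{A}}(C_{n-1},A)\to \mathrm{Hom}_{\mathcal{A}}(C_{n},A)$ given by precomposition with $d_n$. $\mathrm{Nat}(F,G)$ denotes the abelian group (pointwise addition) of natural transformations $F\Rightarrow G$ between functors $\mathcal{A}\to\mathsf{Ab}$. $TC$ is the chain complex of abelian groups obtained by applying $T$ degreewise. A functor between abelian categories is right exact if it preserves finite colimits. *)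

theory Defs
  imports "HOL-Algebra.Coset"
begin

section \<open>Categories and functors\<close>

record ('o, 'm) cat =
  Ob :: "'o set"
  Arr :: "'m set"
  Dom :: "'m \<Rightarrow> 'o"
  Cod :: "'m \<Rightarrow> 'o"
  Ide :: "'o \<Rightarrow> 'm"
  Comp :: "'m \<Rightarrow> 'm \<Rightarrow> 'm"  \<comment> \<open>\<open>Comp C g f\<close> is \<open>g\<close> after \<open>f\<close>\<close>

definition Hom :: "('o, 'm, 'e) cat_scheme \<Rightarrow> 'o \<Rightarrow> 'o \<Rightarrow> 'm set"
  where "Hom C X Y = {f \<in> Arr C. Dom C f = X \<and> Cod C f = Y}"

locale category =
  fixes C :: "('o, 'm, 'e) cat_scheme"
  assumes Dom_closed: "f \<in> Arr C \<Longrightarrow> Dom C f \<in> Ob C"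
    and Cod_closed: "f \<in> Arr C \<Longrightarrow> Cod C f \<in> Ob C"
    and Ide_closed: "X \<in> Ob C \<Longrightarrow> Ide C X \<in> Hom C X X"
    and Comp_closed: "\<lbrakk>f \<in> Hom C X Y; g \<in> Hom C Y Z\<rbrakk> \<Longrightarrow> Comp C g f \<in> Hom C X Z"
    and Comp_Ide: "f \<in> Hom C X Y \<Longrightarrow> Comp C f (Ide C X) = f"
    and Ide_Comp: "f \<in> Hom C X Y \<Longrightarrow> Comp C (Ide C Y) f = f"
    and Comp_assoc: "\<lbrakk>f \<in> Hom C W X; g \<in> Hom C X Y; h \<in> Hom C Y Z\<rbrakk>
      \<Longrightarrow> Comp C h (Comp C g f) = Comp C (Comp C h g) f"

record ('o1, 'm1, 'o2, 'm2) fctr =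
  FOb :: "'o1 \<Rightarrow> 'o2"
  FArr :: "'m1 \<Rightarrow> 'm2"

definition is_functor ::
  "('o1, 'm1, 'e1) cat_scheme \<Rightarrow> ('o2, 'm2, 'e2) cat_scheme \<Rightarrow> ('o1, 'm1, 'o2, 'm2) fctr \<Rightarrow> bool"
  where "is_functor A B F \<longleftrightarrow>
    (\<forall>X \<in> Ob A. FOb F X \<in> Ob B) \<and>
    (\<forall>f \<in> Arr A. FArr F f \<in> Hom B (FOb F (Dom A f)) (FOb F (Cod A f))) \<and>
    (\<forall>X \<in> Ob A. FArr F (Ide A X) = Ide B (FOb F X)) \<and>
    (\<forall>f \<in> Arr A. \<forall>g \<in> Arr A. Cod A f = Dom A g \<longrightarrow>
      FArr F (Comp A g f) = Comp B (FArr F g) (FArr F f))"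

definition fctr_comp ::
  "('o2, 'm2, 'o3, 'm3) fctr \<Rightarrow> ('o1, 'm1, 'o2, 'm2) fctr \<Rightarrow> ('o1, 'm1, 'o3, 'm3) fctr"
  where "fctr_comp G F = \<lparr>FOb = FOb G \<circ> FOb F, FArr = FArr G \<circ> FArr F\<rparr>"

definition is_cocone ::
  "('j, 'u, 'e1) cat_scheme \<Rightarrow> ('o, 'm, 'e2) cat_scheme \<Rightarrow> ('j, 'u, 'o, 'm) fctr \<Rightarrow> 'o \<Rightarrow> ('j \<Rightarrow> 'm) \<Rightarrow> bool"
  where "is_cocone J C D L \<iota> \<longleftrightarrow>
    L \<in> Ob C \<and>
    (\<forall>j \<in> Ob J. \<iota> j \<in> Hom C (FOb D j) L) \<and>
    (\<forall>u \<in> Arr J. Comp C (\<iota> (Cod J u)) (FArr D u) = \<iota> (Dom J u))"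

definition is_colimit ::
  "('j, 'u, 'e1) cat_scheme \<Rightarrow> ('o, 'm, 'e2) cat_scheme \<Rightarrow> ('j, 'u, 'o, 'm) fctr \<Rightarrow> 'o \<Rightarrow> ('j \<Rightarrow> 'm) \<Rightarrow> bool"
  where "is_colimit J C D L \<iota> \<longleftrightarrow>
    is_cocone J C D L \<iota> \<and>
    (\<forall>M \<mu>. is_cocone J C D M \<mu> \<longrightarrow>
      (\<exists>!h. h \<in> Hom C L M \<and> (\<forall>j \<in> Ob J. Comp C h (\<iota> j) = \<mu> j)))"

text \<open>
  Every finite category is isomorphic to one whose objects and arrows are natural numbers, so the
  index categories range over \<open>(nat, nat) cat\<close> without loss of generality.
\<close>

definition right_exact ::
  "('o1, 'm1, 'e1) cat_scheme \<Rightarrow> ('o2, 'm2, 'e2) cat_scheme \<Rightarrow> ('o1, 'm1, 'o2, 'm2) fctr \<Rightarrow> bool"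
  where "right_exact A B F \<longleftrightarrow>
    is_functor A B F \<and>
    (\<forall>(J :: (nat, nat) cat) D L \<iota>.
      category J \<and> finite (Ob J) \<and> finite (Arr J) \<and> is_functor J A D \<and> is_colimit J A D L \<iota>
      \<longrightarrow> is_colimit J B (fctr_comp F D) (FOb F L) (\<lambda>j. FArr F (\<iota> j)))"


section \<open>Abelian categories\<close>

record ('o, 'm) precat = "('o, 'm) cat" +
  Add :: "'m \<Rightarrow> 'm \<Rightarrow> 'm"
  Zero :: "'o \<Rightarrow> 'o \<Rightarrow> 'm"

text \<open>All abelian groups are rendered as \<^locale>\<open>comm_group\<close>s, that is, in multiplicative notation.\<close>

definition Hom_group :: "('o, 'm, 'e) precat_scheme \<Rightarrow> 'o \<Rightarrow> 'o \<Rightarrow> 'm monoid"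
  where "Hom_group A X Y = \<lparr>carrier = Hom A X Y, monoid.mult = Add A, one = Zero A X Y\<rparr>"

locale preadditive_category = category A for A :: "('o, 'm, 'e) precat_scheme" +
  assumes Hom_group: "\<lbrakk>X \<in> Ob A; Y \<in> Ob A\<rbrakk> \<Longrightarrow> comm_group (Hom_group A X Y)"
    and Comp_Add_left: "\<lbrakk>f \<in> Hom A X Y; g \<in> Hom A Y Z; g' \<in> Hom A Y Z\<rbrakk>
      \<Longrightarrow> Comp A (Add A g g') f = Add A (Comp A g f) (Comp A g' f)"
    and Comp_Add_right: "\<lbrakk>f \<in> Hom A X Y; f' \<in> Hom A X Y; g \<in> Hom A Y Z\<rbrakk>
      \<Longrightarrow> Comp A g (Add A f f') = Add A (Comp A g f) (Comp A g f')"

definition is_zero_object :: "('o, 'm, 'e) cat_scheme \<Rightarrow> 'o \<Rightarrow> bool"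
  where "is_zero_object A Z \<longleftrightarrow>
    Z \<in> Ob A \<and> (\<forall>X \<in> Ob A. (\<exists>!f. f \<in> Hom A X Z) \<and> (\<exists>!f. f \<in> Hom A Z X))"

definition is_biproduct ::
  "('o, 'm, 'e) precat_scheme \<Rightarrow> 'o \<Rightarrow> 'o \<Rightarrow> 'o \<Rightarrow> 'm \<Rightarrow> 'm \<Rightarrow> 'm \<Rightarrow> 'm \<Rightarrow> bool"
  where "is_biproduct A X Y B i j p q \<longleftrightarrow>
    B \<in> Ob A \<and> i \<in> Hom A X B \<and> j \<in> Hom A Y B \<and> p \<in> Hom A B X \<and> q \<in> Hom A B Y \<and>
    Comp A p i = Ide A X \<and> Comp A q j = Ide A Y \<and>
    Comp A p j = Zero A Y X \<and> Comp A q i = Zero A X Y \<and>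
    Add A (Comp A i p) (Comp A j q) = Ide A B"

definition is_kernel :: "('o, 'm, 'e) precat_scheme \<Rightarrow> 'm \<Rightarrow> 'm \<Rightarrow> bool"
  where "is_kernel A k f \<longleftrightarrow>
    k \<in> Arr A \<and> f \<in> Arr A \<and> Cod A k = Dom A f \<and>
    Comp A f k = Zero A (Dom A k) (Cod A f) \<and>
    (\<forall>h \<in> Arr A. Cod A h = Dom A f \<and> Comp A f h = Zero A (Dom A h) (Cod A f) \<longrightarrow>
      (\<exists>!u. u \<in> Hom A (Dom A h) (Dom A k) \<and> Comp A k u = h))"

definition is_cokernel :: "('o, 'm, 'e) precat_scheme \<Rightarrow> 'm \<Rightarrow> 'm \<Rightarrow> bool"
  where "is_cokernel A c f \<longleftrightarrow>
    c \<in> Arr A \<and> f \<in> Arr A \<and> Dom A c = Cod A f \<and>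
    Comp A c f = Zero A (Dom A f) (Cod A c) \<and>
    (\<forall>h \<in> Arr A. Dom A h = Cod A f \<and> Comp A h f = Zero A (Dom A f) (Cod A h) \<longrightarrow>
      (\<exists>!u. u \<in> Hom A (Cod A c) (Cod A h) \<and> Comp A u c = h))"

definition is_mono :: "('o, 'm, 'e) cat_scheme \<Rightarrow> 'm \<Rightarrow> bool"
  where "is_mono A f \<longleftrightarrow> f \<in> Arr A \<and>
    (\<forall>W. \<forall>g \<in> Hom A W (Dom A f). \<forall>h \<in> Hom A W (Dom A f). Comp A f g = Comp A f h \<longrightarrow> g = h)"

definition is_epi :: "('o, 'm, 'e) cat_scheme \<Rightarrow> 'm \<Rightarrow> bool"
  where "is_epi A f \<longleftrightarrow> f \<in> Arr A \<and>
    (\<forall>W. \<forall>g \<in> Hom A (Cod A f) W. \<forall>h \<in> Hom A (Cod A f) W. Comp A g f = Comp A h f \<longrightarrow> g = h)"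

locale abelian_category = preadditive_category A for A :: "('o, 'm, 'e) precat_scheme" +
  assumes ex_zero_object: "\<exists>Z. is_zero_object A Z"
    and ex_biproduct: "\<lbrakk>X \<in> Ob A; Y \<in> Ob A\<rbrakk> \<Longrightarrow> \<exists>B i j p q. is_biproduct A X Y B i j p q"
    and ex_kernel: "f \<in> Arr A \<Longrightarrow> \<exists>k. is_kernel A k f"
    and ex_cokernel: "f \<in> Arr A \<Longrightarrow> \<exists>c. is_cokernel A c f"
    and mono_is_kernel: "is_mono A m \<Longrightarrow> \<exists>f. is_kernel A m f"
    and epi_is_cokernel: "is_epi A e \<Longrightarrow> \<exists>f. is_cokernel A e f"


section \<open>The category of abelian groups\<close>

record 't ab_arrow =
  ab_dom :: "'t monoid"
  ab_cod :: "'t monoid"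
  ab_map :: "'t \<Rightarrow> 't"

text \<open>
  The type variable plays the role of the universe: the objects are all abelian groups whose
  carrier is a subset of \<open>'t\<close>. Testing universal properties in \<open>Ab\<close> only against groups over \<open>'t\<close>
  is harmless for \<open>right_exact A Ab T\<close> with \<open>A\<close> abelian, even if \<open>'t\<close> is finite. Quotients of groups
  over \<open>'t\<close> are again isomorphic to groups over \<open>'t\<close>, so preserved coequalizers are genuine. If \<open>S\<close> is
  a coproduct of \<open>G\<close> and \<open>H\<close> in \<open>Ab\<close>, then using \<open>G\<close> and \<open>H\<close> as test objects embeds \<open>G \<times> H\<close> in \<open>S\<close>,
  so preserved coproducts are genuine as well, and with them all preserved finite colimits.
\<close>

definition Ab :: "('t monoid, 't ab_arrow) cat"
  where "Ab = \<lparr>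
    Ob = {G. comm_group G},
    Arr = {f. comm_group (ab_dom f) \<and> comm_group (ab_cod f) \<and>
              ab_map f \<in> hom (ab_dom f) (ab_cod f) \<inter> extensional (carrier (ab_dom f))},
    Dom = ab_dom,
    Cod = ab_cod,
    Ide = (\<lambda>G. \<lparr>ab_dom = G, ab_cod = G, ab_map = (\<lambda>x \<in> carrier G. x)\<rparr>),
    Comp = (\<lambda>g f. \<lparr>ab_dom = ab_dom f, ab_cod = ab_cod g,
                   ab_map = compose (carrier (ab_dom f)) (ab_map g) (ab_map f)\<rparr>)\<rparr>"

text \<open>
  Natural transformations between functors to \<^const>\<open>Ab\<close>. The two functors may take values in
  groups over different types. A transformation is an object-indexed family of homomorphisms, made
  unique by being undefined outside the objects and outside the carriers.
\<close>

definition Nat_group ::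
  "('o, 'm, 'e) cat_scheme \<Rightarrow> ('o, 'm, 's monoid, 's ab_arrow) fctr \<Rightarrow> ('o, 'm, 't monoid, 't ab_arrow) fctr
    \<Rightarrow> ('o \<Rightarrow> 's \<Rightarrow> 't) monoid"
  where "Nat_group A F G = \<lparr>
    carrier = {\<eta> \<in> extensional (Ob A).
      (\<forall>X \<in> Ob A. \<eta> X \<in> hom (FOb F X) (FOb G X) \<inter> extensional (carrier (FOb F X))) \<and>
      (\<forall>f \<in> Arr A. \<forall>x \<in> carrier (FOb F (Dom A f)).
        \<eta> (Cod A f) (ab_map (FArr F f) x) = ab_map (FArr G f) (\<eta> (Dom A f) x))},
    monoid.mult = (\<lambda>\<eta> \<theta>. \<lambda>X \<in> Ob A. \<lambda>x \<in> carrier (FOb F X). \<eta> X x \<otimes>\<^bsub>FOb G X\<^esub> \<theta> X x),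
    one = (\<lambda>X \<in> Ob A. \<lambda>x \<in> carrier (FOb F X). \<one>\<^bsub>FOb G X\<^esub>)\<rparr>"

text \<open>\<open>vcomp A F \<eta> \<theta>\<close> is the vertical composite of \<open>\<theta>\<close>, whose source is \<open>F\<close>, followed by \<open>\<eta>\<close>.\<close>

definition vcomp ::
  "('o, 'm, 'e) cat_scheme \<Rightarrow> ('o, 'm, 's monoid, 's ab_arrow) fctr
    \<Rightarrow> ('o \<Rightarrow> 't \<Rightarrow> 'u) \<Rightarrow> ('o \<Rightarrow> 's \<Rightarrow> 't) \<Rightarrow> 'o \<Rightarrow> 's \<Rightarrow> 'u"
  where "vcomp A F \<eta> \<theta> = (\<lambda>X \<in> Ob A. compose (carrier (FOb F X)) (\<eta> X) (\<theta> X))"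


section \<open>Complexes and (co)homology\<close>

record ('o, 'm) cpx =
  obj :: "int \<Rightarrow> 'o"
  diff :: "int \<Rightarrow> 'm"

definition chain_complex :: "('o, 'm, 'e) precat_scheme \<Rightarrow> ('o, 'm) cpx \<Rightarrow> bool"
  where "chain_complex A C \<longleftrightarrow>
    (\<forall>n. obj C n \<in> Ob A) \<and>
    (\<forall>n. diff C n \<in> Hom A (obj C n) (obj C (n - 1))) \<and>
    (\<forall>n. Comp A (diff C n) (diff C (n + 1)) = Zero A (obj C (n + 1)) (obj C (n - 1)))"

definition is_chain_map ::
  "('o, 'm, 'e) precat_scheme \<Rightarrow> ('o, 'm) cpx \<Rightarrow> ('o, 'm) cpx \<Rightarrow> (int \<Rightarrow> 'm) \<Rightarrow> bool"
  where "is_chain_map A C D f \<longleftrightarrow>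
    (\<forall>n. f n \<in> Hom A (obj C n) (obj D n)) \<and>
    (\<forall>n. Comp A (diff D n) (f n) = Comp A (f (n - 1)) (diff C n))"

definition map_cpx :: "('o1, 'm1, 'o2, 'm2) fctr \<Rightarrow> ('o1, 'm1) cpx \<Rightarrow> ('o2, 'm2) cpx"
  where "map_cpx T C = \<lparr>obj = (\<lambda>n. FOb T (obj C n)), diff = (\<lambda>n. FArr T (diff C n))\<rparr>"

text \<open>Kernel of \<open>g\<close> modulo image of \<open>f\<close>, for composable homomorphisms \<open>f\<close> and \<open>g\<close>.\<close>

definition homology_at :: "'t ab_arrow \<Rightarrow> 't ab_arrow \<Rightarrow> 't set monoid"
  where "homology_at f g =
    (ab_dom g)\<lparr>carrier := kernel (ab_dom g) (ab_cod g) (ab_map g)\<rparr> Mod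
    (ab_map f ` carrier (ab_dom f))"

text \<open>
  The map induced by \<open>\<phi>\<close> from the homology at \<open>(f, g)\<close> to the homology at a pair \<open>(f', g')\<close>. The
  coset of \<open>x\<close> goes to the coset of \<open>\<phi> x\<close>, which is the product of the image of \<open>f'\<close> with the
  image under \<open>\<phi>\<close> of the whole coset of \<open>x\<close>.
\<close>

definition homology_map_at ::
  "'t ab_arrow \<Rightarrow> 't ab_arrow \<Rightarrow> 't ab_arrow \<Rightarrow> 't ab_arrow \<Rightarrow> 't set \<Rightarrow> 't set"
  where "homology_map_at f g f' \<phi> =
    (\<lambda>S \<in> carrier (homology_at f g).
      (ab_map f' ` carrier (ab_dom f')) <#>\<^bsub>ab_cod \<phi>\<^esub> (ab_map \<phi> ` S))"

definition homology :: "('t monoid, 't ab_arrow) cpx \<Rightarrow> int \<Rightarrow> 't set monoid"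
  where "homology K n = homology_at (diff K (n + 1)) (diff K n)"

definition homology_map ::
  "('t monoid, 't ab_arrow) cpx \<Rightarrow> ('t monoid, 't ab_arrow) cpx \<Rightarrow> (int \<Rightarrow> 't ab_arrow)
    \<Rightarrow> int \<Rightarrow> 't set \<Rightarrow> 't set"
  where "homology_map K L \<phi> n =
    homology_map_at (diff K (n + 1)) (diff K n) (diff L (n + 1)) (\<phi> n)"

text \<open>
  Cochain complexes use the same record, but \<open>diff K n\<close> then goes from degree \<open>n - 1\<close> to degree
  \<open>n\<close>, matching the indexing of \<open>d\<^sub>n\<^sup>*\<close>.
\<close>

definition cohomology :: "('t monoid, 't ab_arrow) cpx \<Rightarrow> int \<Rightarrow> 't set monoid"
  where "cohomology K n = homology_at (diff K n) (diff K (n + 1))"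

definition cohomology_map ::
  "('t monoid, 't ab_arrow) cpx \<Rightarrow> ('t monoid, 't ab_arrow) cpx \<Rightarrow> (int \<Rightarrow> 't ab_arrow)
    \<Rightarrow> int \<Rightarrow> 't set \<Rightarrow> 't set"
  where "cohomology_map K L \<phi> n =
    homology_map_at (diff K n) (diff K (n + 1)) (diff L n) (\<phi> n)"


section \<open>The functor \<open>H\<^sup>n Hom(C, -)\<close>\<close>

text \<open>Precomposition with \<open>f\<close>, on homomorphism groups into \<open>X\<close>.\<close>

definition precomp :: "('o, 'm, 'e) precat_scheme \<Rightarrow> 'm \<Rightarrow> 'o \<Rightarrow> 'm ab_arrow"
  where "precomp A f X = \<lparr>
    ab_dom = Hom_group A (Cod A f) X,
    ab_cod = Hom_group A (Dom A f) X,
    ab_map = (\<lambda>h \<in> Hom A (Cod A f) X. Comp A h f)\<rparr>"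

text \<open>Postcomposition with \<open>f\<close>, on homomorphism groups out of \<open>X\<close>.\<close>

definition postcomp :: "('o, 'm, 'e) precat_scheme \<Rightarrow> 'o \<Rightarrow> 'm \<Rightarrow> 'm ab_arrow"
  where "postcomp A X f = \<lparr>
    ab_dom = Hom_group A X (Dom A f),
    ab_cod = Hom_group A X (Cod A f),
    ab_map = (\<lambda>h \<in> Hom A X (Dom A f). Comp A f h)\<rparr>"

definition Hom_cpx :: "('o, 'm, 'e) precat_scheme \<Rightarrow> ('o, 'm) cpx \<Rightarrow> 'o \<Rightarrow> ('m monoid, 'm ab_arrow) cpx"
  where "Hom_cpx A C X =
    \<lparr>obj = (\<lambda>n. Hom_group A (obj C n) X), diff = (\<lambda>n. precomp A (diff C n) X)\<rparr>"

definition HnHom ::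
  "('o, 'm, 'e) precat_scheme \<Rightarrow> ('o, 'm) cpx \<Rightarrow> int \<Rightarrow> ('o, 'm, 'm set monoid, 'm set ab_arrow) fctr"
  where "HnHom A C n = \<lparr>
    FOb = (\<lambda>X. cohomology (Hom_cpx A C X) n),
    FArr = (\<lambda>f. \<lparr>
      ab_dom = cohomology (Hom_cpx A C (Dom A f)) n,
      ab_cod = cohomology (Hom_cpx A C (Cod A f)) n,
      ab_map = cohomology_map (Hom_cpx A C (Dom A f)) (Hom_cpx A C (Cod A f))
                 (\<lambda>k. postcomp A (obj C k) f) n\<rparr>)\<rparr>"

text \<open>
  For a chain map \<open>f\<close> from \<open>C\<close> to \<open>D\<close>, the induced natural transformation from \<open>H\<^sup>n Hom(D, -)\<close>
  to \<open>H\<^sup>n Hom(C, -)\<close>.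
\<close>

definition HnHom_map ::
  "('o, 'm, 'e) precat_scheme \<Rightarrow> ('o, 'm) cpx \<Rightarrow> ('o, 'm) cpx \<Rightarrow> (int \<Rightarrow> 'm) \<Rightarrow> int
    \<Rightarrow> 'o \<Rightarrow> 'm set \<Rightarrow> 'm set"
  where "HnHom_map A C D f n =
    (\<lambda>X \<in> Ob A. cohomology_map (Hom_cpx A D X) (Hom_cpx A C X) (\<lambda>k. precomp A (f k) X) n)"

text \<open>
  The chain map from \<open>T C\<close> to \<open>T' C\<close> given by the components of a natural transformation \<open>\<tau>\<close>
  from \<open>T\<close> to \<open>T'\<close>.
\<close>

definition nat_cpx ::
  "('o, 'm, 't monoid, 't ab_arrow) fctr \<Rightarrow> ('o, 'm, 't monoid, 't ab_arrow) fctr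
    \<Rightarrow> ('o \<Rightarrow> 't \<Rightarrow> 't) \<Rightarrow> ('o, 'm) cpx \<Rightarrow> int \<Rightarrow> 't ab_arrow"
  where "nat_cpx T T' \<tau> C n =
    \<lparr>ab_dom = FOb T (obj C n), ab_cod = FOb T' (obj C n), ab_map = \<tau> (obj C n)\<rparr>"

end

theory Submission
  imports Defs
begin

text \<open>
  Let \<open>c: C\<^sub>n \<rightarrow> Q\<close> be the cokernel of \<open>d\<^sub>n\<^sub>+\<^sub>1\<close> and write \<open>d\<^sub>n = e c\<close>. Then \<open>n\<close>-cocycles with values
  in \<open>X\<close> are the same as arrows \<open>Q \<rightarrow> X\<close>, so \<open>H\<^sup>n Hom(C, -)\<close> is the cokernel of
  \<open>e\<^sup>*: Hom(C\<^sub>n\<^sub>-\<^sub>1, -) \<rightarrow> Hom(Q, -)\<close>. By the Yoneda lemma, the transformations to \<open>T\<close> correspond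
  to the kernel of \<open>T e: T Q \<rightarrow> T C\<^sub>n\<^sub>-\<^sub>1\<close>. As \<open>T\<close> is right exact, \<open>T Q\<close> is the cokernel of
  \<open>T d\<^sub>n\<^sub>+\<^sub>1\<close>, so that this kernel is \<open>H\<^sub>n(T C)\<close>.
\<close>

section \<open>Abelian groups\<close>

text \<open>The correspondence with \<open>T Q\<close> needs \<open>T\<close> to be additive: two
  arrows out of \<open>Q\<close> giving the same cohomology class differ by an arrow
  \<open>k e\<close>, and \<open>T\<close> must turn that sum into a sum if the transformation
  attached to an element of the kernel of \<open>T e\<close> is to be well defined. Right exactness
  speaks only of colimits, so additivity is derived from preserved biproducts, once preservation of
  the zero object has shown that zero arrows go to trivial homomorphisms. A second obstacle is that
  universal properties in \<open>Ab\<close> can be tested only against groups over the type of the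
  values of \<open>T\<close>. Exactness in terms of elements comes from testing against two
  quotients, one of \<open>T C_n\<close> and one of \<open>T Q\<close>, so quotients are needed over
  the given type and not as groups of sets. The isomorphism sends a transformation to a fibre of
  \<open>T c\<close>: as a homology class is itself a set, no representative has to be
  chosen.\<close>

lemma Hom_Ab_iff:
  "f \<in> Hom Ab G H \<longleftrightarrow> comm_group G \<and> comm_group H \<and> ab_dom f = G \<and> ab_cod f = H \<and>
    ab_map f \<in> hom G H \<and> ab_map f \<in> extensional (carrier G)"
  by (auto simp: Hom_def Ab_def)

lemma Hom_Ab_D:
  assumes "f \<in> Hom Ab G H"
  shows "comm_group G" "comm_group H" "ab_dom f = G" "ab_cod f = H" "ab_map f \<in> hom G H"
    "ab_map f \<in> extensional (carrier G)" "group_hom G H (ab_map f)"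
    "x \<in> carrier G \<Longrightarrow> ab_map f x \<in> carrier H"
  using assms
  by (auto simp: Hom_Ab_iff comm_group_def group_hom_def group_hom_axioms_def hom_def)

lemma Hom_Ab_eqI:
  assumes "f \<in> Hom Ab G H" "g \<in> Hom Ab G H" "\<And>x. x \<in> carrier G \<Longrightarrow> ab_map f x = ab_map g x"
  shows "f = g"
proof -
  have "ab_map f = ab_map g"
    using assms by (intro extensionalityI[of _ "carrier G"]) (auto simp: Hom_Ab_iff)
  with assms show ?thesis
    by (auto simp: Hom_Ab_iff)
qed

lemma ab_map_Comp_Ab:
  "x \<in> carrier (ab_dom f) \<Longrightarrow> ab_map (Comp Ab g f) x = ab_map g (ab_map f x)"
  by (simp add: Ab_def compose_def)

lemma Comp_Ab_closed:
  assumes "f \<in> Hom Ab G H" "g \<in> Hom Ab H K"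
  shows "Comp Ab g f \<in> Hom Ab G K"
proof -
  have "compose (carrier G) (ab_map g) (ab_map f) \<in> hom G K"
    using assms by (auto simp: Hom_Ab_iff hom_def compose_def Pi_iff group.is_monoid comm_group_def monoid.m_closed)
  with assms show ?thesis
    by (simp add: Hom_Ab_iff) (simp add: Ab_def)
qed

text \<open>\<open>Ab\<close> is a bare \<open>cat\<close> without a \<open>Zero\<close> field, so
  its zero arrows are built by hand; restricting the constant map to the carrier makes it
  extensional, as \<open>Arr\<close> requires.\<close>

definition trivial_arrow :: "'t monoid \<Rightarrow> 't monoid \<Rightarrow> 't ab_arrow"
  where "trivial_arrow G H =
    \<lparr>ab_dom = G, ab_cod = H, ab_map = (\<lambda>x \<in> carrier G. \<one>\<^bsub>H\<^esub>)\<rparr>"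

lemma trivial_arrow_closed:
  assumes "comm_group G" "comm_group H"
  shows "trivial_arrow G H \<in> Hom Ab G H"
proof -
  interpret G: comm_group G by fact
  interpret H: comm_group H by fact
  show ?thesis
    using assms by (auto simp: Hom_Ab_iff trivial_arrow_def hom_def)
qed

lemma ab_map_trivial_arrow: "x \<in> carrier G \<Longrightarrow> ab_map (trivial_arrow G H) x = \<one>\<^bsub>H\<^esub>"
  by (simp add: trivial_arrow_def)

text \<open>The cosets are represented by elements of the original group, so that the quotient stays
  over the same type.\<close>

lemma ex_quotient_arrow:
  fixes G :: "'a monoid"
  assumes "comm_group G" "subgroup N G"
  obtains Q \<pi> where "\<pi> \<in> Hom Ab G Q" "\<And>x. x \<in> carrier G \<Longrightarrow> ab_map \<pi> x = \<one>\<^bsub>Q\<^esub> \<longleftrightarrow> x \<in> N"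
proof -
  interpret G: comm_group G by fact
  interpret N: normal N G using assms(2) by (rule G.subgroup_imp_normal)
  \<comment> \<open>The choice is made from the coset as a set, hence equal cosets have equal
    representatives.\<close>
  define r where "r x = (SOME y. y \<in> N #>\<^bsub>G\<^esub> x)" for x
  have r_mem: "r x \<in> N #>\<^bsub>G\<^esub> x" if "x \<in> carrier G" for x
    unfolding r_def using G.rcos_self[OF that assms(2)] by (rule someI)
  have r_closed: "r x \<in> carrier G" if "x \<in> carrier G" for x
    using N.elemrcos_carrier[OF G.is_group that r_mem[OF that]] .
  have coset_r: "N #>\<^bsub>G\<^esub> r x = N #>\<^bsub>G\<^esub> x" if "x \<in> carrier G" for x
    using G.repr_independence[OF r_mem[OF that] that assms(2)] by simp
  have r_eq: "r x = r y" if "N #>\<^bsub>G\<^esub> x = N #>\<^bsub>G\<^esub> y" for x y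
    using that by (simp add: r_def)
  \<comment> \<open>\<open>H\<close> only carries the multiplication: once \<open>r\<close> respects
    products, its image is a commutative group.\<close>
  define H where "H = \<lparr>carrier = (UNIV :: 'a set), monoid.mult = \<lambda>a b. r (a \<otimes>\<^bsub>G\<^esub> b), one = r \<one>\<^bsub>G\<^esub>\<rparr>"
  have "r \<in> hom G H"
    by (auto simp: hom_def H_def r_closed coset_r N.rcos_sum[symmetric] intro!: r_eq)
  define Q where "Q = H\<lparr>carrier := r ` carrier G, one := r \<one>\<^bsub>G\<^esub>\<rparr>"
  have Q: "comm_group Q"
    unfolding Q_def by (rule G.hom_imp_img_comm_group) fact
  define \<pi> where "\<pi> = \<lparr>ab_dom = G, ab_cod = Q, ab_map = (\<lambda>x \<in> carrier G. r x)\<rparr>"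
  have "\<pi> \<in> Hom Ab G Q"
    using \<open>r \<in> hom G H\<close> Q assms(1) by (auto simp: Hom_Ab_iff \<pi>_def Q_def hom_def)
  moreover have "ab_map \<pi> x = \<one>\<^bsub>Q\<^esub> \<longleftrightarrow> x \<in> N" if x: "x \<in> carrier G" for x
  proof -
    have "ab_map \<pi> x = \<one>\<^bsub>Q\<^esub> \<longleftrightarrow> r x = r \<one>\<^bsub>G\<^esub>"
      using x by (simp add: \<pi>_def Q_def)
    also have "\<dots> \<longleftrightarrow> N #>\<^bsub>G\<^esub> x = N #>\<^bsub>G\<^esub> \<one>\<^bsub>G\<^esub>"
      using coset_r[OF x] coset_r[OF G.one_closed] r_eq by metis
    also have "\<dots> \<longleftrightarrow> x \<in> N"
      using x assms(2) by (metis G.coset_join1 G.coset_join2 G.coset_mult_one N.subset)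
    finally show ?thesis .
  qed
  ultimately show thesis
    by (rule that)
qed

section \<open>Homology classes\<close>

text \<open>The coset is taken in the whole group, so that only \<open>f\<close> enters; for a cycle
  it is the same set as its coset inside the kernel.\<close>

definition hclass :: "'t ab_arrow \<Rightarrow> 't \<Rightarrow> 't set"
  where "hclass f x = (ab_map f ` carrier (ab_dom f)) #>\<^bsub>ab_cod f\<^esub> x"

text \<open>Covers the chain complex \<open>T C\<close>, where \<open>f\<close> lowers the degree,
  and the cochain complexes \<open>Hom(C, X)\<close>, where \<open>f\<close> is precomposition with
  a differential and raises it.\<close>

locale ab_seq =
  fixes f g :: "'t ab_arrow" and F G H
  assumes f: "f \<in> Hom Ab F G" and g: "g \<in> Hom Ab G H"
    and g_f: "x \<in> carrier F \<Longrightarrow> ab_map g (ab_map f x) = \<one>\<^bsub>H\<^esub>"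
begin

sublocale G: comm_group G
  using f by (rule Hom_Ab_D)

sublocale f: group_hom F G "ab_map f"
  using f by (rule Hom_Ab_D)

sublocale g: group_hom G H "ab_map g"
  using g by (rule Hom_Ab_D)

lemma dom_cod [simp]: "ab_dom f = F" "ab_cod f = G" "ab_dom g = G" "ab_cod g = H"
  using f g by (auto dest: Hom_Ab_D)

lemma mem_hclass: "y \<in> hclass f x \<longleftrightarrow> (\<exists>z \<in> carrier F. y = ab_map f z \<otimes>\<^bsub>G\<^esub> x)"
  by (auto simp: hclass_def r_coset_def)

lemma hclass_self: "x \<in> carrier G \<Longrightarrow> x \<in> hclass f x"
  by (simp add: hclass_def G.rcos_self f.img_is_subgroup)

lemma hclass_mem_eq: "x \<in> carrier G \<Longrightarrow> y \<in> hclass f x \<Longrightarrow> hclass f y = hclass f x"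
  using G.repr_independence[OF _ _ f.img_is_subgroup] by (simp add: hclass_def)

lemma hclass_eq_iff:
  assumes "x \<in> carrier G" "y \<in> carrier G"
  shows "hclass f x = hclass f y \<longleftrightarrow> (\<exists>z \<in> carrier F. x = ab_map f z \<otimes>\<^bsub>G\<^esub> y)"
  using hclass_self[OF assms(1)] hclass_mem_eq[OF assms(2)]
  by (metis mem_hclass)

lemma normal_image: "(ab_map f ` carrier F) \<lhd> (G\<lparr>carrier := kernel G H (ab_map g)\<rparr>)"
proof -
  let ?K = "kernel G H (ab_map g)"
  have "ab_map f ` carrier F \<subseteq> ?K"
    using g_f by (auto simp: kernel_def)
  then have "subgroup (ab_map f ` carrier F) (G\<lparr>carrier := ?K\<rparr>)"
    by (intro G.subgroup_incl f.img_is_subgroup g.subgroup_kernel)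
  moreover have "comm_group (G\<lparr>carrier := ?K\<rparr>)"
    by (intro group.group_comm_groupI subgroup.subgroup_is_group[OF g.subgroup_kernel])
      (auto simp: kernel_def G.m_comm G.is_group)
  ultimately show ?thesis
    by (intro comm_group.subgroup_imp_normal)
qed

lemma carrier_homology_at:
  "carrier (homology_at f g) = hclass f ` {x \<in> carrier G. ab_map g x = \<one>\<^bsub>H\<^esub>}"
  by (auto simp: homology_at_def FactGroup_def RCOSETS_def hclass_def r_coset_def kernel_def)

lemma one_homology_at: "\<one>\<^bsub>homology_at f g\<^esub> = hclass f \<one>\<^bsub>G\<^esub>"
  using G.coset_join2[OF G.one_closed f.img_is_subgroup subgroup.one_closed[OF f.img_is_subgroup]]
  by (simp add: homology_at_def FactGroup_def hclass_def)

lemma mult_homology_at: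
  assumes "x \<in> carrier G" "ab_map g x = \<one>\<^bsub>H\<^esub>" "y \<in> carrier G" "ab_map g y = \<one>\<^bsub>H\<^esub>"
  shows "hclass f x \<otimes>\<^bsub>homology_at f g\<^esub> hclass f y = hclass f (x \<otimes>\<^bsub>G\<^esub> y)"
  using normal.rcos_sum[OF normal_image, of x y] assms
  by (simp add: homology_at_def FactGroup_def hclass_def kernel_def r_coset_def set_mult_def)

end

text \<open>The condition \<open>comm\<close> says that \<open>\<phi>\<close> maps boundaries to
  boundaries. Hence the image of the coset of \<open>x\<close> lies in the coset of
  \<open>ab_map \<phi> x\<close>, and multiplying it by all boundaries of the target fills that
  coset.\<close>

lemma homology_map_at_hclass:
  assumes "ab_seq f g F G H" "ab_seq f' g' F' G' H'" and \<phi>: "\<phi> \<in> Hom Ab G G'"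
    and comm: "\<And>z. z \<in> carrier F \<Longrightarrow> \<exists>z' \<in> carrier F'. ab_map \<phi> (ab_map f z) = ab_map f' z'"
    and x: "x \<in> carrier G" "ab_map g x = \<one>\<^bsub>H\<^esub>"
  shows "homology_map_at f g f' \<phi> (hclass f x) = hclass f' (ab_map \<phi> x)"
proof -
  interpret S: ab_seq f g F G H by fact
  interpret S': ab_seq f' g' F' G' H' by fact
  interpret \<phi>: group_hom G G' "ab_map \<phi>" using \<phi> by (rule Hom_Ab_D)
  have "hclass f x \<in> carrier (homology_at f g)"
    using x by (auto simp: S.carrier_homology_at)
  then have eq: "homology_map_at f g f' \<phi> (hclass f x) =
      (ab_map f' ` carrier F') <#>\<^bsub>G'\<^esub> (ab_map \<phi> ` hclass f x)"
    using \<phi> by (simp add: homology_map_at_def Hom_Ab_iff)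
  also have "\<dots> = hclass f' (ab_map \<phi> x)"
  proof (intro equalityI subsetI)
    fix w assume "w \<in> (ab_map f' ` carrier F') <#>\<^bsub>G'\<^esub> (ab_map \<phi> ` hclass f x)"
    then obtain u z where u: "u \<in> carrier F'" and z: "z \<in> carrier F"
      and w: "w = ab_map f' u \<otimes>\<^bsub>G'\<^esub> ab_map \<phi> (ab_map f z \<otimes>\<^bsub>G\<^esub> x)"
      by (auto simp: set_mult_def S.mem_hclass)
    obtain z' where z': "z' \<in> carrier F'" "ab_map \<phi> (ab_map f z) = ab_map f' z'"
      using comm[OF z] by blast
    have "w = ab_map f' (u \<otimes>\<^bsub>F'\<^esub> z') \<otimes>\<^bsub>G'\<^esub> ab_map \<phi> x"
      using w u z z' x by (simp add: S'.G.m_assoc)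
    then show "w \<in> hclass f' (ab_map \<phi> x)"
      using u z'(1) S'.f.G.m_closed S'.mem_hclass by blast
  next
    fix w assume "w \<in> hclass f' (ab_map \<phi> x)"
    then show "w \<in> (ab_map f' ` carrier F') <#>\<^bsub>G'\<^esub> (ab_map \<phi> ` hclass f x)"
      using S.hclass_self[OF x(1)] by (auto simp: S'.mem_hclass set_mult_def)
  qed
  finally show ?thesis .
qed

section \<open>Right exact functors to abelian groups\<close>

interpretation Ab: category "Ab :: ('a monoid, 'a ab_arrow) cat"
proof
  fix f g h :: "'a ab_arrow" and G H K L :: "'a monoid"
  show "f \<in> Arr Ab \<Longrightarrow> Dom Ab f \<in> Ob Ab" "f \<in> Arr Ab \<Longrightarrow> Cod Ab f \<in> Ob Ab"
    by (auto simp: Ab_def)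
  show Ide: "Ide Ab G \<in> Hom Ab G G" if "G \<in> Ob Ab" for G :: "'a monoid"
    using that by (simp add: Hom_Ab_iff) (auto simp: Ab_def hom_def comm_group_def group.is_monoid monoid.m_closed)
  show "f \<in> Hom Ab G H \<Longrightarrow> g \<in> Hom Ab H K \<Longrightarrow> Comp Ab g f \<in> Hom Ab G K"
    by (rule Comp_Ab_closed)
  have map_Ide: "ab_map (Ide Ab G) x = x" if "x \<in> carrier G" for x and G :: "'a monoid"
    using that by (simp add: Ab_def)
  show "Comp Ab f (Ide Ab G) = f" if f: "f \<in> Hom Ab G H"
  proof -
    have G: "Ide Ab G \<in> Hom Ab G G"
      by (rule Ide) (use Hom_Ab_D(1)[OF f] in \<open>simp add: Ab_def\<close>)
    show ?thesis
      by (rule Hom_Ab_eqI[OF Comp_Ab_closed[OF G f] f])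
        (use G in \<open>simp add: Hom_Ab_iff ab_map_Comp_Ab map_Ide\<close>)
  qed
  show "Comp Ab (Ide Ab H) f = f" if f: "f \<in> Hom Ab G H"
  proof -
    have H: "Ide Ab H \<in> Hom Ab H H"
      by (rule Ide) (use Hom_Ab_D(2)[OF f] in \<open>simp add: Ab_def\<close>)
    show ?thesis
      by (rule Hom_Ab_eqI[OF Comp_Ab_closed[OF f H] f])
        (use Hom_Ab_D[OF f] in \<open>simp add: ab_map_Comp_Ab map_Ide\<close>)
  qed
  show "Comp Ab h (Comp Ab g f) = Comp Ab (Comp Ab h g) f"
    if f: "f \<in> Hom Ab G H" and g: "g \<in> Hom Ab H K" and h: "h \<in> Hom Ab K L"
    by (rule Hom_Ab_eqI[OF Comp_Ab_closed[OF Comp_Ab_closed[OF f g] h]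
          Comp_Ab_closed[OF f Comp_Ab_closed[OF g h]]])
      (use Hom_Ab_D[OF f] Hom_Ab_D[OF g] Hom_Ab_D[OF Comp_Ab_closed[OF f g]]
        in \<open>simp add: ab_map_Comp_Ab\<close>)
qed

section \<open>Composition with zero arrows in a preadditive category\<close>

context preadditive_category
begin

lemma Hom_in_Ob: "f \<in> Hom A X Y \<Longrightarrow> X \<in> Ob A" "f \<in> Hom A X Y \<Longrightarrow> Y \<in> Ob A"
  using Dom_closed Cod_closed by (auto simp: Hom_def)

lemma Zero_closed: "X \<in> Ob A \<Longrightarrow> Y \<in> Ob A \<Longrightarrow> Zero A X Y \<in> Hom A X Y"
  using comm_group.axioms(2)[OF Hom_group] group.is_monoid monoid.one_closed
  by (fastforce simp: Hom_group_def)

lemma Add_closed: "f \<in> Hom A X Y \<Longrightarrow> g \<in> Hom A X Y \<Longrightarrow> Add A f g \<in> Hom A X Y"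
  using comm_group.axioms(2)[OF Hom_group[OF Hom_in_Ob]] group.is_monoid monoid.m_closed
  by (fastforce simp: Hom_group_def)

lemma Add_Zero: "f \<in> Hom A X Y \<Longrightarrow> Add A f (Zero A X Y) = f"
  using comm_group.axioms(2)[OF Hom_group[OF Hom_in_Ob]] group.is_monoid monoid.r_one
  by (fastforce simp: Hom_group_def)

lemma Zero_Add: "f \<in> Hom A X Y \<Longrightarrow> Add A (Zero A X Y) f = f"
  using comm_group.axioms(2)[OF Hom_group[OF Hom_in_Ob]] group.is_monoid monoid.l_one
  by (fastforce simp: Hom_group_def)

text \<open>Bilinearity is assumed for \<open>Add\<close> only. As zero plus zero is zero,
  composites with a zero arrow are idempotent for \<open>Add\<close>; cancellation then makes them
  zero.\<close>

lemma Add_idem_imp_Zero: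
  assumes "f \<in> Hom A X Y" "Add A f f = f"
  shows "f = Zero A X Y"
proof -
  interpret H: comm_group "Hom_group A X Y"
    using assms(1) by (intro Hom_group Hom_in_Ob)
  show ?thesis
    using H.r_cancel_one[of f f] assms by (simp add: Hom_group_def)
qed

lemma Comp_Zero_left:
  assumes f: "f \<in> Hom A X Y" and Z: "Z \<in> Ob A"
  shows "Comp A (Zero A Y Z) f = Zero A X Z"
proof -
  have z: "Zero A Y Z \<in> Hom A Y Z"
    using f Z by (blast intro: Zero_closed Hom_in_Ob)
  show ?thesis
    using Comp_Add_left[OF f z z] z by (intro Add_idem_imp_Zero Comp_closed[OF f z]) (simp add: Add_Zero)
qed

lemma Comp_Zero_right:
  assumes f: "f \<in> Hom A Y Z" and X: "X \<in> Ob A"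
  shows "Comp A f (Zero A X Y) = Zero A X Z"
proof -
  have z: "Zero A X Y \<in> Hom A X Y"
    using f X by (blast intro: Zero_closed Hom_in_Ob)
  show ?thesis
    using Comp_Add_right[OF z z f] z by (intro Add_idem_imp_Zero Comp_closed[OF z f]) (simp add: Add_Zero)
qed

end

section \<open>Finite diagrams: the empty one, pairs of objects and parallel pairs of arrows\<close>

definition discrete_cat :: "nat \<Rightarrow> (nat, nat) cat"
  where "discrete_cat k =
    \<lparr>Ob = {..<k}, Arr = {..<k}, Dom = id, Cod = id, Ide = id, Comp = (\<lambda>g f. f)\<rparr>"

text \<open>The arrows 0 and 1 are the identities, 2 and 3 the two parallel arrows from 0 to 1.\<close>

definition parallel_cat :: "(nat, nat) cat"
  where "parallel_cat =
    \<lparr>Ob = {0, 1}, Arr = {0, 1, 2, 3}, Dom = (\<lambda>u. if u = 1 then 1 else 0),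
     Cod = (\<lambda>u. if u = 0 then 0 else 1), Ide = id, Comp = (\<lambda>g f. if f = 0 then g else f)\<rparr>"

lemma category_discrete_cat: "category (discrete_cat k)"
  by unfold_locales (auto simp: discrete_cat_def Hom_def)

lemma category_parallel_cat: "category parallel_cat"
proof -
  have Hom: "f \<in> Hom parallel_cat X Y \<longleftrightarrow>
      f = 0 \<and> X = 0 \<and> Y = 0 \<or> f = 1 \<and> X = 1 \<and> Y = 1 \<or> (f = 2 \<or> f = 3) \<and> X = 0 \<and> Y = 1" for f X Y
    by (auto simp: Hom_def parallel_cat_def)
  have "Comp parallel_cat g f = (if f = 0 then g else f)" "Ide parallel_cat = id"
    "Ob parallel_cat = {0, 1}" "Arr parallel_cat = {0, 1, 2, 3}"
    "Dom parallel_cat f \<in> {0, 1}" "Cod parallel_cat f \<in> {0, 1}" for f g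
    by (simp_all add: parallel_cat_def)
  then show ?thesis
    by unfold_locales (auto simp: Hom)
qed

text \<open>Over \<open>discrete_cat 2\<close> this is the diagram of a binary coproduct; over
  \<open>discrete_cat 0\<close> it is the empty diagram, whatever \<open>X\<close> and
  \<open>Y\<close> are.\<close>

definition pair_fctr :: "('o, 'm, 'e) cat_scheme \<Rightarrow> 'o \<Rightarrow> 'o \<Rightarrow> (nat, nat, 'o, 'm) fctr"
  where "pair_fctr A X Y =
    \<lparr>FOb = (\<lambda>j. if j = 0 then X else Y), FArr = (\<lambda>j. if j = 0 then Ide A X else Ide A Y)\<rparr>"

definition parallel_fctr ::
  "('o, 'm, 'e) cat_scheme \<Rightarrow> 'm \<Rightarrow> 'm \<Rightarrow> (nat, nat, 'o, 'm) fctr"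
  where "parallel_fctr A f g =
    \<lparr>FOb = (\<lambda>j. if j = 0 then Dom A f else Cod A f),
     FArr = (\<lambda>u. if u = 0 then Ide A (Dom A f) else if u = 1 then Ide A (Cod A f)
       else if u = 2 then f else g)\<rparr>"

context category
begin

lemma is_functor_pair_fctr:
  assumes "X \<in> Ob C" "Y \<in> Ob C"
  shows "is_functor (discrete_cat k) C (pair_fctr C X Y)"
  using assms Ide_closed Comp_Ide[OF Ide_closed]
  by (auto simp: is_functor_def pair_fctr_def discrete_cat_def)

lemma is_functor_parallel_fctr:
  assumes "f \<in> Hom C X Y" "g \<in> Hom C X Y"
  shows "is_functor parallel_cat C (parallel_fctr C f g)"
proof -
  have "X \<in> Ob C" "Y \<in> Ob C"
    using assms(1) Dom_closed Cod_closed by (auto simp: Hom_def)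
  moreover have "Dom C f = X" "Cod C f = Y"
    using assms(1) by (auto simp: Hom_def)
  ultimately show ?thesis
    using assms Ide_closed[of X] Ide_closed[of Y] Comp_Ide[OF assms(1)] Comp_Ide[OF assms(2)]
      Ide_Comp[OF assms(1)] Ide_Comp[OF assms(2)] Comp_Ide[OF Ide_closed]
    by (auto simp: is_functor_def parallel_fctr_def parallel_cat_def)
qed

end

lemma cokernel_ex1:
  assumes c: "is_cokernel A c f" "c \<in> Hom A Y Q" and f: "f \<in> Hom A X Y"
    and h: "h \<in> Hom A Y M" "Comp A h f = Zero A X M"
  shows "\<exists>!u. u \<in> Hom A Q M \<and> Comp A u c = h"
proof -
  have *: "h \<in> Arr A" "Dom A h = Y" "Cod A h = M" "Dom A f = X" "Cod A f = Y" "Cod A c = Q"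
    using c(2) f h(1) by (auto simp: Hom_def)
  have "Dom A h = Cod A f \<and> Comp A h f = Zero A (Dom A f) (Cod A h) \<longrightarrow>
      (\<exists>!u. u \<in> Hom A (Cod A c) (Cod A h) \<and> Comp A u c = h)"
    using c(1) *(1) by (simp add: is_cokernel_def)
  then show ?thesis
    using * h(2) by simp
qed

section \<open>Zero arrows, sums and cokernels under a right exact functor\<close>

locale right_exact_functor = abelian_category A
  for A :: "('o, 'm, 'e) precat_scheme" +
  fixes T :: "('o, 'm, 't monoid, 't ab_arrow) fctr"
  assumes right_exact: "right_exact A Ab T"
begin

abbreviation Tm :: "'m \<Rightarrow> 't \<Rightarrow> 't" where "Tm f \<equiv> ab_map (FArr T f)"
abbreviation To :: "'o \<Rightarrow> 't set" where "To X \<equiv> carrier (FOb T X)"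

lemma is_functor_T: "is_functor A Ab T"
  using right_exact by (simp add: right_exact_def)

lemma FOb_T: "X \<in> Ob A \<Longrightarrow> comm_group (FOb T X)"
  using is_functor_T by (auto simp: is_functor_def Ab_def)

lemma FArr_T: "f \<in> Hom A X Y \<Longrightarrow> FArr T f \<in> Hom Ab (FOb T X) (FOb T Y)"
  using is_functor_T by (auto simp: is_functor_def Hom_def)

lemma group_hom_Tm: "f \<in> Hom A X Y \<Longrightarrow> group_hom (FOb T X) (FOb T Y) (Tm f)"
  using FArr_T by (rule Hom_Ab_D)

lemma Tm_closed: "f \<in> Hom A X Y \<Longrightarrow> x \<in> To X \<Longrightarrow> Tm f x \<in> To Y"
  using FArr_T by (rule Hom_Ab_D)

lemma Tm_Ide: "X \<in> Ob A \<Longrightarrow> x \<in> To X \<Longrightarrow> Tm (Ide A X) x = x"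
  using is_functor_T by (auto simp: is_functor_def) (simp add: Ab_def)

lemma FArr_T_Comp:
  "f \<in> Hom A X Y \<Longrightarrow> g \<in> Hom A Y Z \<Longrightarrow> FArr T (Comp A g f) = Comp Ab (FArr T g) (FArr T f)"
  using is_functor_T by (auto simp: is_functor_def Hom_def)

lemma Tm_Comp:
  assumes f: "f \<in> Hom A X Y" and "g \<in> Hom A Y Z" "x \<in> To X"
  shows "Tm (Comp A g f) x = Tm g (Tm f x)"
  using assms Hom_Ab_D(3)[OF FArr_T[OF f]] by (simp add: FArr_T_Comp ab_map_Comp_Ab)

lemma preserves_colimit:
  fixes J :: "(nat, nat) cat"
  assumes "category J" "finite (Ob J)" "finite (Arr J)" "is_functor J A D" "is_colimit J A D L \<iota>"
  shows "is_colimit J Ab (fctr_comp T D) (FOb T L) (\<lambda>j. FArr T (\<iota> j))"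
  using right_exact assms by (auto simp: right_exact_def)

text \<open>A zero object is a colimit of the empty diagram, so its image under \<open>T\<close> is
  initial in \<open>Ab\<close> and all arrows out of that image are trivial; a zero arrow factors
  through the zero object.\<close>

lemma Tm_Zero:
  assumes X: "X \<in> Ob A" and Y: "Y \<in> Ob A" and x: "x \<in> To X"
  shows "Tm (Zero A X Y) x = \<one>\<^bsub>FOb T Y\<^esub>"
proof -
  obtain Z where Z: "is_zero_object A Z"
    using ex_zero_object by blast
  then have Z_Ob: "Z \<in> Ob A"
    by (simp add: is_zero_object_def)
  let ?J = "discrete_cat 0" and ?D = "pair_fctr A Z Z"
  have "is_colimit ?J A ?D Z \<iota>" for \<iota>
    using Z by (auto simp: is_colimit_def is_cocone_def is_zero_object_def discrete_cat_def)
  \<comment> \<open>There is no index at which a leg is evaluated, so any family of legs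
    serves.\<close>
  then have "is_colimit ?J Ab (fctr_comp T ?D) (FOb T Z) (\<lambda>j. FArr T (undefined j))"
    by (intro preserves_colimit is_functor_pair_fctr category_discrete_cat Z_Ob)
      (auto simp: discrete_cat_def)
  then have "\<exists>!h. h \<in> Hom Ab (FOb T Z) G" if "comm_group G" for G
    using that unfolding is_colimit_def is_cocone_def
    by (auto simp: discrete_cat_def Ab_def)
  moreover have "trivial_arrow (FOb T Z) (FOb T Y) \<in> Hom Ab (FOb T Z) (FOb T Y)"
    by (intro trivial_arrow_closed FOb_T Z_Ob Y)
  moreover have "FArr T (Zero A Z Y) \<in> Hom Ab (FOb T Z) (FOb T Y)"
    by (intro FArr_T Zero_closed Z_Ob Y)
  ultimately have eq: "FArr T (Zero A Z Y) = trivial_arrow (FOb T Z) (FOb T Y)"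
    using FOb_T[OF Y] by blast
  have XZ: "Zero A X Z \<in> Hom A X Z" and ZY: "Zero A Z Y \<in> Hom A Z Y"
    by (intro Zero_closed X Y Z_Ob)+
  have "Tm (Zero A X Y) x = Tm (Zero A Z Y) (Tm (Zero A X Z) x)"
    using Tm_Comp[OF XZ ZY x] Comp_Zero_left[OF XZ Y] by simp
  also have "\<dots> = \<one>\<^bsub>FOb T Y\<^esub>"
    using Tm_closed[OF XZ x] by (simp add: eq ab_map_trivial_arrow)
  finally show ?thesis .
qed

text \<open>A biproduct is a coproduct: a cocone \<open>\<mu>\<close> is mediated by
  \<open>\<mu> 0\<close> after \<open>p\<close> plus \<open>\<mu> 1\<close> after \<open>q\<close>.
  As \<open>T\<close> preserves it, joint cancellation of the two injections is the uniqueness half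
  of the preserved universal property.\<close>

lemma T_biproduct_jointly_epi:
  assumes B: "is_biproduct A X Y B i j p q" and X: "X \<in> Ob A" and Y: "Y \<in> Ob A"
    and h: "h \<in> Hom Ab (FOb T B) G" "h' \<in> Hom Ab (FOb T B) G"
    and eq_i: "Comp Ab h (FArr T i) = Comp Ab h' (FArr T i)"
    and eq_j: "Comp Ab h (FArr T j) = Comp Ab h' (FArr T j)"
  shows "h = h'"
proof -
  have i: "i \<in> Hom A X B" and j: "j \<in> Hom A Y B" and p: "p \<in> Hom A B X" and q: "q \<in> Hom A B Y"
    and pi: "Comp A p i = Ide A X" and qj: "Comp A q j = Ide A Y"
    and pj: "Comp A p j = Zero A Y X" and qi: "Comp A q i = Zero A X Y"
    and sum: "Add A (Comp A i p) (Comp A j q) = Ide A B" and B_Ob: "B \<in> Ob A"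
    using B by (auto simp: is_biproduct_def)
  let ?J = "discrete_cat 2" and ?D = "pair_fctr A X Y"
  let ?\<iota> = "\<lambda>k::nat. if k = 0 then i else j"
  have J: "Ob ?J = {0, 1}" "Arr ?J = {0, 1}" "Dom ?J = id" "Cod ?J = id"
    by (auto simp: discrete_cat_def)
  have "is_cocone ?J A ?D B ?\<iota>"
    using i j B_Ob Comp_Ide by (auto simp: is_cocone_def J pair_fctr_def)
  moreover have "\<exists>!u. u \<in> Hom A B M \<and> (\<forall>k \<in> Ob ?J. Comp A u (?\<iota> k) = \<mu> k)"
    if "is_cocone ?J A ?D M \<mu>" for M \<mu>
  proof (rule ex1I)
    have \<mu>: "\<mu> 0 \<in> Hom A X M" "\<mu> 1 \<in> Hom A Y M"
      using that by (auto simp: is_cocone_def J pair_fctr_def)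
    let ?u = "Add A (Comp A (\<mu> 0) p) (Comp A (\<mu> 1) q)"
    have m: "Comp A (\<mu> 0) p \<in> Hom A B M" "Comp A (\<mu> 1) q \<in> Hom A B M"
      using Comp_closed p q \<mu> by blast+
    have "Comp A ?u i = \<mu> 0"
      using Comp_Add_left[OF i m] Comp_assoc[OF i p \<mu>(1), symmetric] Comp_assoc[OF i q \<mu>(2), symmetric] \<mu>
        Comp_Zero_right[OF \<mu>(2) X]
      by (simp add: pi qi Comp_Ide Add_Zero)
    moreover have "Comp A ?u j = \<mu> 1"
      using Comp_Add_left[OF j m] Comp_assoc[OF j p \<mu>(1), symmetric] Comp_assoc[OF j q \<mu>(2), symmetric] \<mu>
        Comp_Zero_right[OF \<mu>(1) Y]
      by (simp add: pj qj Comp_Ide Zero_Add)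
    ultimately show "?u \<in> Hom A B M \<and> (\<forall>k \<in> Ob ?J. Comp A ?u (?\<iota> k) = \<mu> k)"
      using Add_closed[OF m] by (simp add: J)
    fix u assume u: "u \<in> Hom A B M \<and> (\<forall>k \<in> Ob ?J. Comp A u (?\<iota> k) = \<mu> k)"
    then have "u = Comp A u (Add A (Comp A i p) (Comp A j q))"
      using Comp_Ide[of u B M] by (simp add: sum)
    also have "\<dots> = Add A (Comp A u (Comp A i p)) (Comp A u (Comp A j q))"
      using u Comp_closed i j p q by (intro Comp_Add_right) auto
    also have "\<dots> = ?u"
      using u Comp_assoc[OF p i, of u M] Comp_assoc[OF q j, of u M] by (simp add: J)
    finally show "u = ?u" .
  qed
  ultimately have "is_colimit ?J A ?D B ?\<iota>"
    by (auto simp: is_colimit_def)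
  then have colim: "is_colimit ?J Ab (fctr_comp T ?D) (FOb T B) (\<lambda>k. FArr T (?\<iota> k))"
    by (intro preserves_colimit is_functor_pair_fctr category_discrete_cat X Y)
      (simp_all add: J)
  \<comment> \<open>The composites of \<open>h\<close> with the injections form a cocone for which
    both \<open>h\<close> and \<open>h'\<close> mediate.\<close>
  let ?\<mu> = "\<lambda>k::nat. Comp Ab h (FArr T (?\<iota> k))"
  have Ti: "FArr T i \<in> Hom Ab (FOb T X) (FOb T B)" and Tj: "FArr T j \<in> Hom Ab (FOb T Y) (FOb T B)"
    using i j by (auto intro: FArr_T)
  have T_Ide: "FArr T (Ide A X) = Ide Ab (FOb T X)" "FArr T (Ide A Y) = Ide Ab (FOb T Y)"
    using is_functor_T X Y by (auto simp: is_functor_def)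
  have "G \<in> Ob Ab"
    using Hom_Ab_D(2)[OF h(1)] by (simp add: Ab_def)
  then have "is_cocone ?J Ab (fctr_comp T ?D) G ?\<mu>"
    using Comp_Ab_closed[OF Ti h(1)] Comp_Ab_closed[OF Tj h(1)]
      Ab.Comp_Ide[OF Comp_Ab_closed[OF Ti h(1)]] Ab.Comp_Ide[OF Comp_Ab_closed[OF Tj h(1)]]
    by (simp add: is_cocone_def J fctr_comp_def pair_fctr_def T_Ide)
  then have "\<exists>!u. u \<in> Hom Ab (FOb T B) G \<and> (\<forall>k \<in> Ob ?J. Comp Ab u (FArr T (?\<iota> k)) = ?\<mu> k)"
    using colim unfolding is_colimit_def by blast
  then show ?thesis
    using h eq_i eq_j by (auto simp: J)
qed

text \<open>The sum factors as \<open>X -> B -> Y\<close>, the diagonal \<open>i + j\<close>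
  followed by \<open>s = f p + g q\<close>. By joint cancellation, \<open>T s\<close> is determined
  by its composites with \<open>T i\<close> and \<open>T j\<close>, hence is the pointwise sum of
  \<open>T f\<close> after \<open>T p\<close> and \<open>T g\<close> after \<open>T q\<close>; on
  the diagonal both projections are the identity.\<close>

lemma Tm_Add:
  assumes f: "f \<in> Hom A X Y" and g: "g \<in> Hom A X Y" and x: "x \<in> To X"
  shows "Tm (Add A f g) x = Tm f x \<otimes>\<^bsub>FOb T Y\<^esub> Tm g x"
proof -
  have X: "X \<in> Ob A" and Y: "Y \<in> Ob A"
    using f by (auto dest: Hom_in_Ob)
  obtain B i j p q where B: "is_biproduct A X X B i j p q"
    using ex_biproduct X by blast
  then have i: "i \<in> Hom A X B" and j: "j \<in> Hom A X B" and p: "p \<in> Hom A B X" and q: "q \<in> Hom A B X"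
    and pi: "Comp A p i = Ide A X" and qj: "Comp A q j = Ide A X"
    and pj: "Comp A p j = Zero A X X" and qi: "Comp A q i = Zero A X X"
    by (auto simp: is_biproduct_def)
  interpret TY: comm_group "FOb T Y" using Y by (rule FOb_T)
  let ?s = "Add A (Comp A f p) (Comp A g q)" and ?\<Delta> = "Add A i j"
  have fp: "Comp A f p \<in> Hom A B Y" and gq: "Comp A g q \<in> Hom A B Y"
    using Comp_closed p q f g by blast+
  have s: "?s \<in> Hom A B Y" and \<Delta>: "?\<Delta> \<in> Hom A X B"
    using Add_closed fp gq i j by blast+
  have si: "Comp A ?s i = f"
    using Comp_Add_left[OF i fp gq] Comp_assoc[OF i p f, symmetric] Comp_assoc[OF i q g, symmetric] f g
    by (simp add: pi qi Comp_Ide Comp_Zero_right[OF g X] Add_Zero)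
  have sj: "Comp A ?s j = g"
    using Comp_Add_left[OF j fp gq] Comp_assoc[OF j p f, symmetric] Comp_assoc[OF j q g, symmetric] f g
    by (simp add: pj qj Comp_Ide Comp_Zero_right[OF f X] Zero_Add)
  have s\<Delta>: "Comp A ?s ?\<Delta> = Add A f g"
    using Comp_Add_right[OF i j s] by (simp add: si sj)
  have p\<Delta>: "Comp A p ?\<Delta> = Ide A X" "Comp A q ?\<Delta> = Ide A X"
    using Comp_Add_right[OF i j p] Comp_Add_right[OF i j q]
    by (simp_all add: pi pj qi qj Add_Zero Zero_Add Ide_closed X)
  \<comment> \<open>The candidate for \<open>T\<close> of \<open>?s\<close>; it is a homomorphism
    because \<open>FOb T Y\<close> is commutative.\<close>
  define h where "h = \<lparr>ab_dom = FOb T B, ab_cod = FOb T Y,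
    ab_map = (\<lambda>y \<in> To B. Tm f (Tm p y) \<otimes>\<^bsub>FOb T Y\<^esub> Tm g (Tm q y))\<rparr>"
  have B_Ob: "B \<in> Ob A"
    using i by (auto dest: Hom_in_Ob)
  interpret Tf: group_hom "FOb T X" "FOb T Y" "Tm f" using f by (rule group_hom_Tm)
  interpret Tg: group_hom "FOb T X" "FOb T Y" "Tm g" using g by (rule group_hom_Tm)
  interpret Tp: group_hom "FOb T B" "FOb T X" "Tm p" using p by (rule group_hom_Tm)
  interpret Tq: group_hom "FOb T B" "FOb T X" "Tm q" using q by (rule group_hom_Tm)
  have h: "h \<in> Hom Ab (FOb T B) (FOb T Y)"
    using FOb_T[OF B_Ob] FOb_T[OF Y]
    by (auto simp: Hom_Ab_iff h_def hom_def TY.m_ac)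
  have Ts: "FArr T ?s \<in> Hom Ab (FOb T B) (FOb T Y)"
    and Ti: "FArr T i \<in> Hom Ab (FOb T X) (FOb T B)" and Tj: "FArr T j \<in> Hom Ab (FOb T X) (FOb T B)"
    using s i j by (auto intro: FArr_T)
  have "FArr T ?s = h"
  proof (rule T_biproduct_jointly_epi[OF B X X Ts h])
    show "Comp Ab (FArr T ?s) (FArr T i) = Comp Ab h (FArr T i)"
    proof (rule Hom_Ab_eqI[OF Comp_Ab_closed[OF Ti Ts] Comp_Ab_closed[OF Ti h]])
      fix y assume y: "y \<in> To X"
      have "Tm ?s (Tm i y) = Tm f y"
        using Tm_Comp[OF i s y] by (simp add: si)
      moreover have "Tm p (Tm i y) = y" "Tm q (Tm i y) = \<one>\<^bsub>FOb T X\<^esub>"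
        using Tm_Comp[OF i p y] Tm_Comp[OF i q y] Tm_Ide[OF X y] Tm_Zero[OF X X y]
        by (simp_all add: pi qi)
      ultimately show "ab_map (Comp Ab (FArr T ?s) (FArr T i)) y = ab_map (Comp Ab h (FArr T i)) y"
        using y Tm_closed[OF i y] Hom_Ab_D(3)[OF Ti] by (simp add: ab_map_Comp_Ab h_def)
    qed
    show "Comp Ab (FArr T ?s) (FArr T j) = Comp Ab h (FArr T j)"
    proof (rule Hom_Ab_eqI[OF Comp_Ab_closed[OF Tj Ts] Comp_Ab_closed[OF Tj h]])
      fix y assume y: "y \<in> To X"
      have "Tm ?s (Tm j y) = Tm g y"
        using Tm_Comp[OF j s y] by (simp add: sj)
      moreover have "Tm q (Tm j y) = y" "Tm p (Tm j y) = \<one>\<^bsub>FOb T X\<^esub>"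
        using Tm_Comp[OF j p y] Tm_Comp[OF j q y] Tm_Ide[OF X y] Tm_Zero[OF X X y]
        by (simp_all add: pj qj)
      ultimately show "ab_map (Comp Ab (FArr T ?s) (FArr T j)) y = ab_map (Comp Ab h (FArr T j)) y"
        using y Tm_closed[OF j y] Hom_Ab_D(3)[OF Tj] by (simp add: ab_map_Comp_Ab h_def)
    qed
  qed
  then have "Tm (Add A f g) x = ab_map h (Tm ?\<Delta> x)"
    using Tm_Comp[OF \<Delta> s x] by (simp add: s\<Delta>)
  then show ?thesis
    using Tm_closed[OF \<Delta> x] Tm_Comp[OF \<Delta> p x] Tm_Comp[OF \<Delta> q x] Tm_Ide[OF X x]
    by (simp add: h_def p\<Delta>)
qed

text \<open>A cokernel of \<open>f\<close> is a coequalizer of \<open>f\<close> and the zero arrow,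
  a finite colimit. By \<open>Tm_Zero\<close> the image of the zero arrow is trivial, so a
  homomorphism killing the image of \<open>T f\<close> yields a cocone under the image
  diagram.\<close>

lemma T_cokernel_universal:
  assumes c: "is_cokernel A c f" "c \<in> Hom A Y Q" and f: "f \<in> Hom A X Y"
    and h: "h \<in> Hom Ab (FOb T Y) G" and hf: "\<And>x. x \<in> To X \<Longrightarrow> ab_map h (Tm f x) = \<one>\<^bsub>G\<^esub>"
  shows "\<exists>!u. u \<in> Hom Ab (FOb T Q) G \<and> Comp Ab u (FArr T c) = h"
proof -
  have X: "X \<in> Ob A" and Y: "Y \<in> Ob A" and Q: "Q \<in> Ob A"
    using f c(2) by (auto dest: Hom_in_Ob)
  have dom_cod: "Dom A f = X" "Cod A f = Y" "Dom A c = Y" "Cod A c = Q"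
    using f c(2) by (auto simp: Hom_def)
  let ?z = "Zero A X Y"
  have z: "?z \<in> Hom A X Y"
    using X Y by (rule Zero_closed)
  have cf: "Comp A c f = Zero A X Q"
    using c(1) by (simp add: is_cokernel_def dom_cod)
  let ?J = parallel_cat and ?D = "parallel_fctr A f ?z"
  let ?\<iota> = "\<lambda>k::nat. if k = 0 then Zero A X Q else c"
  have J: "Ob ?J = {0, 1}" "Arr ?J = {0, 1, 2, 3}"
    "Dom ?J = (\<lambda>u. if u = 1 then 1 else 0)" "Cod ?J = (\<lambda>u. if u = 0 then 0 else 1)"
    by (auto simp: parallel_cat_def)
  have XQ: "Zero A X Q \<in> Hom A X Q"
    using X Q by (rule Zero_closed)
  have "is_cocone ?J A ?D Q ?\<iota>"
    using Q XQ c(2) Comp_Ide[OF XQ] Comp_Ide[OF c(2)] Comp_Zero_right[OF c(2) X] cf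
    by (simp add: is_cocone_def J parallel_fctr_def dom_cod)
  moreover have "\<exists>!u. u \<in> Hom A Q M \<and> (\<forall>k \<in> Ob ?J. Comp A u (?\<iota> k) = \<mu> k)"
    if cocone: "is_cocone ?J A ?D M \<mu>" for M \<mu>
  proof -
    have M: "M \<in> Ob A" and \<mu>1: "\<mu> 1 \<in> Hom A Y M"
      and \<mu>f: "Comp A (\<mu> 1) f = \<mu> 0" "Comp A (\<mu> 1) ?z = \<mu> 0"
      using cocone by (simp_all add: is_cocone_def J parallel_fctr_def dom_cod)
    have \<mu>0: "\<mu> 0 = Zero A X M"
      using \<mu>f(2) Comp_Zero_right[OF \<mu>1 X] by simp
    have "\<exists>!u. u \<in> Hom A Q M \<and> Comp A u c = \<mu> 1"
      using \<mu>f(1) \<mu>0 by (intro cokernel_ex1[OF c f \<mu>1]) simp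
    \<comment> \<open>The leg at \<open>0\<close> is a zero arrow in both cocones, so only the leg
      at \<open>1\<close> constrains \<open>u\<close>.\<close>
    moreover have "u \<in> Hom A Q M \<and> (\<forall>k \<in> Ob ?J. Comp A u (?\<iota> k) = \<mu> k) \<longleftrightarrow>
        u \<in> Hom A Q M \<and> Comp A u c = \<mu> 1" for u
      using Comp_Zero_right[of u Q M X] X \<mu>0 by (auto simp: J)
    ultimately show ?thesis
      by (simp only:)
  qed
  ultimately have "is_colimit ?J A ?D Q ?\<iota>"
    unfolding is_colimit_def by blast
  then have colim: "is_colimit ?J Ab (fctr_comp T ?D) (FOb T Q) (\<lambda>k. FArr T (?\<iota> k))"
    by (intro preserves_colimit is_functor_parallel_fctr[OF f z] category_parallel_cat)
      (simp_all add: J)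
  let ?t = "trivial_arrow (FOb T X) G"
  let ?\<mu> = "\<lambda>k::nat. if k = 0 then ?t else h"
  have G: "comm_group G"
    using h by (rule Hom_Ab_D)
  have Tf: "FArr T f \<in> Hom Ab (FOb T X) (FOb T Y)" and Tz: "FArr T ?z \<in> Hom Ab (FOb T X) (FOb T Y)"
    and Tc: "FArr T c \<in> Hom Ab (FOb T Y) (FOb T Q)"
    and TXQ: "FArr T (Zero A X Q) \<in> Hom Ab (FOb T X) (FOb T Q)"
    using f z c(2) XQ by (auto intro: FArr_T)
  have t: "?t \<in> Hom Ab (FOb T X) G"
    by (intro trivial_arrow_closed FOb_T X G)
  have "Comp Ab h (FArr T f) = ?t"
    by (rule Hom_Ab_eqI[OF Comp_Ab_closed[OF Tf h] t])
      (simp add: ab_map_Comp_Ab Hom_Ab_D(3)[OF Tf] hf ab_map_trivial_arrow)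
  moreover have "Comp Ab h (FArr T ?z) = ?t"
    using group_hom.hom_one[OF Hom_Ab_D(7)[OF h]]
    by (intro Hom_Ab_eqI[OF Comp_Ab_closed[OF Tz h] t])
      (simp add: ab_map_Comp_Ab Hom_Ab_D(3)[OF Tz] Tm_Zero X Y ab_map_trivial_arrow)
  moreover have "FArr T (Ide A X) = Ide Ab (FOb T X)" "FArr T (Ide A Y) = Ide Ab (FOb T Y)"
    using is_functor_T X Y by (auto simp: is_functor_def)
  moreover have "G \<in> Ob Ab"
    using G by (simp add: Ab_def)
  ultimately have "is_cocone ?J Ab (fctr_comp T ?D) G ?\<mu>"
    using t h Ab.Comp_Ide[OF t] Ab.Comp_Ide[OF h]
    by (simp add: is_cocone_def J parallel_fctr_def dom_cod fctr_comp_def)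
  then have "\<exists>!u. u \<in> Hom Ab (FOb T Q) G \<and> (\<forall>k \<in> Ob ?J. Comp Ab u (FArr T (?\<iota> k)) = ?\<mu> k)"
    using colim unfolding is_colimit_def by blast
  moreover have "u \<in> Hom Ab (FOb T Q) G \<and> (\<forall>k \<in> Ob ?J. Comp Ab u (FArr T (?\<iota> k)) = ?\<mu> k) \<longleftrightarrow>
      u \<in> Hom Ab (FOb T Q) G \<and> Comp Ab u (FArr T c) = h" for u
  proof (cases "u \<in> Hom Ab (FOb T Q) G")
    case u: True
    have "Comp Ab u (FArr T (Zero A X Q)) = ?t"
      using group_hom.hom_one[OF Hom_Ab_D(7)[OF u]]
      by (intro Hom_Ab_eqI[OF Comp_Ab_closed[OF TXQ u] t])
        (simp add: ab_map_Comp_Ab Hom_Ab_D(3)[OF TXQ] Tm_Zero X Q ab_map_trivial_arrow)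
    then show ?thesis
      by (auto simp: J)
  qed simp
  ultimately show ?thesis
    by (simp only:)
qed

text \<open>The universal property is tested on the quotient of \<open>T Y\<close> by the image of
  \<open>T f\<close>. The projection \<open>\<pi>\<close> factors through \<open>T c\<close>, so
  whatever \<open>T c\<close> kills lies in the kernel of \<open>\<pi>\<close>, which is that
  image.\<close>

lemma Tm_cokernel_eq_one_iff:
  assumes c: "is_cokernel A c f" "c \<in> Hom A Y Q" and f: "f \<in> Hom A X Y" and y: "y \<in> To Y"
  shows "Tm c y = \<one>\<^bsub>FOb T Q\<^esub> \<longleftrightarrow> y \<in> Tm f ` To X"
proof
  have X: "X \<in> Ob A" and Y: "Y \<in> Ob A" and Q: "Q \<in> Ob A"
    using f c(2) by (auto dest: Hom_in_Ob)
  interpret Tf: group_hom "FOb T X" "FOb T Y" "Tm f" using f by (rule group_hom_Tm)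
  have Tc: "FArr T c \<in> Hom Ab (FOb T Y) (FOb T Q)"
    using c(2) by (rule FArr_T)
  show "y \<in> Tm f ` To X" if "Tm c y = \<one>\<^bsub>FOb T Q\<^esub>"
  proof -
    obtain G \<pi> where \<pi>: "\<pi> \<in> Hom Ab (FOb T Y) G"
      and ker: "\<And>x. x \<in> To Y \<Longrightarrow> ab_map \<pi> x = \<one>\<^bsub>G\<^esub> \<longleftrightarrow> x \<in> Tm f ` To X"
      using ex_quotient_arrow[OF FOb_T[OF Y] Tf.img_is_subgroup] by metis
    obtain u where u: "u \<in> Hom Ab (FOb T Q) G" "Comp Ab u (FArr T c) = \<pi>"
      using T_cokernel_universal[OF c f \<pi>] ker by auto
    have "ab_map \<pi> y = ab_map u (Tm c y)"
      using y Hom_Ab_D(3)[OF Tc] by (simp flip: u(2) add: ab_map_Comp_Ab)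
    also have "\<dots> = \<one>\<^bsub>G\<^esub>"
      using that group_hom.hom_one[OF Hom_Ab_D(7)[OF u(1)]] by simp
    finally show ?thesis
      using ker y by simp
  qed
  show "Tm c y = \<one>\<^bsub>FOb T Q\<^esub>" if "y \<in> Tm f ` To X"
  proof -
    have "Comp A c f = Zero A X Q"
      using c f by (auto simp: is_cokernel_def Hom_def)
    then show ?thesis
      using that Tm_Comp[OF f c(2)] Tm_Zero[OF X Q] by auto
  qed
qed

text \<open>The universal property is tested on the quotient of \<open>T Q\<close> by the image of
  \<open>T c\<close>. The projection and the trivial arrow agree after \<open>T c\<close>, so the
  projection is trivial and the image is all of \<open>T Q\<close>.\<close>

lemma Tm_cokernel_surj:
  assumes c: "is_cokernel A c f" "c \<in> Hom A Y Q" and f: "f \<in> Hom A X Y"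
  shows "Tm c ` To Y = To Q"
proof
  have X: "X \<in> Ob A" and Y: "Y \<in> Ob A" and Q: "Q \<in> Ob A"
    using f c(2) by (auto dest: Hom_in_Ob)
  interpret Tc: group_hom "FOb T Y" "FOb T Q" "Tm c" using c(2) by (rule group_hom_Tm)
  have Tc: "FArr T c \<in> Hom Ab (FOb T Y) (FOb T Q)"
    using c(2) by (rule FArr_T)
  show "Tm c ` To Y \<subseteq> To Q"
    by auto
  obtain G \<pi> where \<pi>: "\<pi> \<in> Hom Ab (FOb T Q) G"
    and ker: "\<And>x. x \<in> To Q \<Longrightarrow> ab_map \<pi> x = \<one>\<^bsub>G\<^esub> \<longleftrightarrow> x \<in> Tm c ` To Y"
    using ex_quotient_arrow[OF FOb_T[OF Q] Tc.img_is_subgroup] by metis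
  have G: "comm_group G"
    using \<pi> by (rule Hom_Ab_D)
  let ?t = "trivial_arrow (FOb T Y) G" and ?t' = "trivial_arrow (FOb T Q) G"
  have t: "?t \<in> Hom Ab (FOb T Y) G" and t': "?t' \<in> Hom Ab (FOb T Q) G"
    by (intro trivial_arrow_closed FOb_T Y Q G)+
  have "\<exists>!u. u \<in> Hom Ab (FOb T Q) G \<and> Comp Ab u (FArr T c) = ?t"
    by (rule T_cokernel_universal[OF c f t]) (simp add: ab_map_trivial_arrow Tm_closed[OF f])
  moreover have "Comp Ab \<pi> (FArr T c) = ?t"
    by (rule Hom_Ab_eqI[OF Comp_Ab_closed[OF Tc \<pi>] t])
      (simp add: ab_map_Comp_Ab Hom_Ab_D(3)[OF Tc] ker ab_map_trivial_arrow)
  moreover have "Comp Ab ?t' (FArr T c) = ?t"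
    by (rule Hom_Ab_eqI[OF Comp_Ab_closed[OF Tc t'] t])
      (simp add: ab_map_Comp_Ab Hom_Ab_D(3)[OF Tc] ab_map_trivial_arrow)
  ultimately have "\<pi> = ?t'"
    using \<pi> t' by blast
  then show "To Q \<subseteq> Tm c ` To Y"
    using ker by (auto simp: ab_map_trivial_arrow)
qed

end

section \<open>Classes of cocycles\<close>

context preadditive_category
begin

lemma Hom_group_simps [simp]:
  "carrier (Hom_group A X Y) = Hom A X Y" "f \<otimes>\<^bsub>Hom_group A X Y\<^esub> g = Add A f g"
  "\<one>\<^bsub>Hom_group A X Y\<^esub> = Zero A X Y"
  by (simp_all add: Hom_group_def)

lemma precomp_closed:
  assumes f: "f \<in> Hom A X Y" and Z: "Z \<in> Ob A"
  shows "precomp A f Z \<in> Hom Ab (Hom_group A Y Z) (Hom_group A X Z)"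
proof -
  have "Dom A f = X" "Cod A f = Y"
    using f by (auto simp: Hom_def)
  then show ?thesis
    using Hom_group[OF Hom_in_Ob(1)[OF f] Z] Hom_group[OF Hom_in_Ob(2)[OF f] Z]
    by (auto simp: Hom_Ab_iff precomp_def hom_def Add_closed Comp_closed[OF f] Comp_Add_left[OF f])
qed

lemma postcomp_closed:
  assumes f: "f \<in> Hom A X Y" and W: "W \<in> Ob A"
  shows "postcomp A W f \<in> Hom Ab (Hom_group A W X) (Hom_group A W Y)"
proof -
  have "Dom A f = X" "Cod A f = Y"
    using f by (auto simp: Hom_def)
  then show ?thesis
    using Hom_group[OF W Hom_in_Ob(1)[OF f]] Hom_group[OF W Hom_in_Ob(2)[OF f]] f
    by (auto simp: Hom_Ab_iff postcomp_def hom_def Add_closed Comp_closed Comp_Add_right)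
qed

lemma ab_map_precomp: "f \<in> Hom A X Y \<Longrightarrow> h \<in> Hom A Y Z \<Longrightarrow> ab_map (precomp A f Z) h = Comp A h f"
  by (auto simp: precomp_def Hom_def)

lemma ab_map_postcomp: "f \<in> Hom A X Y \<Longrightarrow> h \<in> Hom A W X \<Longrightarrow> ab_map (postcomp A W f) h = Comp A f h"
  by (auto simp: postcomp_def Hom_def)

end

text \<open>One fixed choice for each arrow makes \<open>yoneda_class\<close> a function of the
  complex. The choices for different complexes are linked by the factorization of cocycles.\<close>

definition cokernel_arrow :: "('o, 'm, 'e) precat_scheme \<Rightarrow> 'm \<Rightarrow> 'm"
  where "cokernel_arrow A f = (SOME c. is_cokernel A c f)"

locale complex_at = abelian_category A
  for A :: "('o, 'm, 'e) precat_scheme" +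
  fixes C :: "('o, 'm) cpx" and n :: int
  assumes chain_complex: "chain_complex A C"
begin

text \<open>Named from the side of \<open>obj C n\<close>. Under \<open>Hom(-, X)\<close> the roles
  are exchanged: precomposition with \<open>d_out\<close> yields the coboundaries, and
  precomposition with \<open>d_in\<close> detects the cocycles.\<close>

abbreviation "d_in \<equiv> diff C (n + 1)"
abbreviation "d_out \<equiv> diff C n"
abbreviation "c \<equiv> cokernel_arrow A d_in"
abbreviation "Q \<equiv> Cod A c"
abbreviation "cls X h \<equiv> hclass (precomp A d_out X) h"

definition cocycle :: "'o \<Rightarrow> 'm \<Rightarrow> bool"
  where "cocycle X h \<longleftrightarrow> h \<in> Hom A (obj C n) X \<and> Comp A h d_in = Zero A (obj C (n + 1)) X"

lemma obj_Ob: "obj C k \<in> Ob A"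
  using chain_complex by (simp add: chain_complex_def)

lemma d_out: "d_out \<in> Hom A (obj C n) (obj C (n - 1))"
  using chain_complex by (simp add: chain_complex_def)

lemma d_in: "d_in \<in> Hom A (obj C (n + 1)) (obj C n)"
  using chain_complex by (auto simp: chain_complex_def dest: spec[of _ "n + 1"])

text \<open>The reason why \<open>d_out\<close> factors through \<open>c\<close>, and why every
  coboundary, being an arrow after \<open>d_out\<close>, is a cocycle.\<close>

lemma cocycle_d_out: "cocycle (obj C (n - 1)) d_out"
  using chain_complex d_out by (simp add: chain_complex_def cocycle_def)

lemma cocycle_Comp:
  assumes "cocycle X h" and f: "f \<in> Hom A X Y"
  shows "cocycle Y (Comp A f h)"
proof -
  have h: "h \<in> Hom A (obj C n) X" "Comp A h d_in = Zero A (obj C (n + 1)) X"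
    using assms by (simp_all add: cocycle_def)
  then show ?thesis
    using Comp_assoc[OF d_in h(1) f] Comp_Zero_right[OF f obj_Ob] Comp_closed[OF h(1) f]
    by (simp add: cocycle_def)
qed

lemma is_cokernel_c: "is_cokernel A c d_in"
  unfolding cokernel_arrow_def using d_in
  by (intro someI_ex[of "\<lambda>c. is_cokernel A c d_in"] ex_cokernel) (simp add: Hom_def)

lemma c: "c \<in> Hom A (obj C n) Q"
  using is_cokernel_c d_in by (auto simp: is_cokernel_def Hom_def)

lemma Q: "Q \<in> Ob A"
  using c by (rule Hom_in_Ob)

lemma cocycle_c: "cocycle Q c"
  using is_cokernel_c c d_in by (auto simp: is_cokernel_def cocycle_def Hom_def)

lemma cocycle_Comp_c: "u \<in> Hom A Q X \<Longrightarrow> cocycle X (Comp A u c)"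
  by (rule cocycle_Comp[OF cocycle_c])

lemma cocycle_factor:
  assumes "cocycle X h"
  obtains u where "u \<in> Hom A Q X" "Comp A u c = h"
  using cokernel_ex1[OF is_cokernel_c c d_in, of h X] assms by (auto simp: cocycle_def)

lemma c_epi:
  assumes "u \<in> Hom A Q X" "v \<in> Hom A Q X" "Comp A u c = Comp A v c"
  shows "u = v"
  using cokernel_ex1[OF is_cokernel_c c d_in, of "Comp A v c" X] cocycle_Comp_c[OF assms(2)] assms
  by (auto simp: cocycle_def)

lemma Hom_seq:
  assumes X: "X \<in> Ob A"
  shows "ab_seq (precomp A d_out X) (precomp A d_in X) (Hom_group A (obj C (n - 1)) X)
    (Hom_group A (obj C n) X) (Hom_group A (obj C (n + 1)) X)"
proof
  show "precomp A d_out X \<in> Hom Ab (Hom_group A (obj C (n - 1)) X) (Hom_group A (obj C n) X)"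
    using d_out X by (rule precomp_closed)
  show "precomp A d_in X \<in> Hom Ab (Hom_group A (obj C n) X) (Hom_group A (obj C (n + 1)) X)"
    using d_in X by (rule precomp_closed)
  fix k assume "k \<in> carrier (Hom_group A (obj C (n - 1)) X)"
  then show "ab_map (precomp A d_in X) (ab_map (precomp A d_out X) k) =
      \<one>\<^bsub>Hom_group A (obj C (n + 1)) X\<^esub>"
    using ab_map_precomp[OF d_out, of k X] cocycle_Comp[OF cocycle_d_out, of k X]
    by (simp add: ab_map_precomp[OF d_in] cocycle_def)
qed

lemma FOb_HnHom: "FOb (HnHom A C n) X = homology_at (precomp A d_out X) (precomp A d_in X)"
  by (simp add: HnHom_def cohomology_def Hom_cpx_def)

lemma carrier_HnHom:
  assumes X: "X \<in> Ob A"
  shows "carrier (FOb (HnHom A C n) X) = cls X ` {h. cocycle X h}"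
proof -
  have "{h \<in> Hom A (obj C n) X. ab_map (precomp A d_in X) h = Zero A (obj C (n + 1)) X} = {h. cocycle X h}"
    by (auto simp: cocycle_def ab_map_precomp[OF d_in])
  then show ?thesis
    using ab_seq.carrier_homology_at[OF Hom_seq[OF X]] by (simp add: FOb_HnHom)
qed

lemma cls_in_HnHom: "X \<in> Ob A \<Longrightarrow> cocycle X h \<Longrightarrow> cls X h \<in> carrier (FOb (HnHom A C n) X)"
  by (simp add: carrier_HnHom)

text \<open>The class of \<open>c\<close> generates the functor: every class is its image under some
  \<open>u\<close>, so a natural transformation is known from one value.\<close>

lemma HnHom_cases:
  assumes "X \<in> Ob A" "S \<in> carrier (FOb (HnHom A C n) X)"
  obtains u where "u \<in> Hom A Q X" "S = cls X (Comp A u c)"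
  using assms by (auto simp: carrier_HnHom elim: cocycle_factor)

lemma cls_eq_iff:
  assumes "cocycle X h" "cocycle X h'"
  shows "cls X h = cls X h' \<longleftrightarrow>
    (\<exists>k \<in> Hom A (obj C (n - 1)) X. h = Add A (Comp A k d_out) h')"
proof -
  have h: "h \<in> Hom A (obj C n) X" "h' \<in> Hom A (obj C n) X"
    using assms by (auto simp: cocycle_def)
  then show ?thesis
    using ab_seq.hclass_eq_iff[OF Hom_seq, of X h h'] Hom_in_Ob(2)[OF h(1)]
    by (auto simp: ab_map_precomp[OF d_out])
qed

lemma mult_HnHom:
  assumes "cocycle X h" "cocycle X h'"
  shows "cls X h \<otimes>\<^bsub>FOb (HnHom A C n) X\<^esub> cls X h' = cls X (Add A h h')"
proof -
  have h: "h \<in> Hom A (obj C n) X" "h' \<in> Hom A (obj C n) X"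
    using assms by (auto simp: cocycle_def)
  then show ?thesis
    using ab_seq.mult_homology_at[OF Hom_seq, of X h h'] Hom_in_Ob(2)[OF h(1)] assms
    by (simp add: FOb_HnHom cocycle_def ab_map_precomp[OF d_in])
qed

lemma FArr_HnHom:
  assumes h: "cocycle X h" and f: "f \<in> Hom A X Y"
  shows "ab_map (FArr (HnHom A C n) f) (cls X h) = cls Y (Comp A f h)"
proof -
  have X: "X \<in> Ob A" and Y: "Y \<in> Ob A"
    using f by (auto dest: Hom_in_Ob)
  have h': "h \<in> Hom A (obj C n) X"
    using h by (simp add: cocycle_def)
  have "homology_map_at (precomp A d_out X) (precomp A d_in X) (precomp A d_out Y)
      (postcomp A (obj C n) f) (cls X h) = cls Y (ab_map (postcomp A (obj C n) f) h)"
  proof (rule homology_map_at_hclass[OF Hom_seq[OF X] Hom_seq[OF Y] postcomp_closed[OF f obj_Ob]])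
    fix k assume "k \<in> carrier (Hom_group A (obj C (n - 1)) X)"
    then have k: "k \<in> Hom A (obj C (n - 1)) X"
      by simp
    have "ab_map (postcomp A (obj C n) f) (ab_map (precomp A d_out X) k) =
        ab_map (precomp A d_out Y) (Comp A f k)"
      using ab_map_precomp[OF d_out k] ab_map_precomp[OF d_out Comp_closed[OF k f]]
        ab_map_postcomp[OF f Comp_closed[OF d_out k]] Comp_assoc[OF d_out k f] by simp
    then show "\<exists>z \<in> carrier (Hom_group A (obj C (n - 1)) Y).
        ab_map (postcomp A (obj C n) f) (ab_map (precomp A d_out X) k) = ab_map (precomp A d_out Y) z"
      using Comp_closed[OF k f] by auto
  qed (use h h' in \<open>simp_all add: cocycle_def ab_map_precomp[OF d_in]\<close>)
  moreover have "Dom A f = X" "Cod A f = Y"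
    using f by (auto simp: Hom_def)
  ultimately show ?thesis
    by (simp add: HnHom_def cohomology_map_def Hom_cpx_def ab_map_postcomp[OF f h'])
qed

end

section \<open>Chain maps acting on classes of cocycles\<close>

lemma HnHom_map_cls:
  assumes C: "complex_at A C" and D: "complex_at A D" and f: "is_chain_map A C D f"
    and h: "complex_at.cocycle A D n X h"
  shows "HnHom_map A C D f n X (hclass (precomp A (diff D n) X) h) =
      hclass (precomp A (diff C n) X) (Comp A h (f n))"
    and "complex_at.cocycle A C n X (Comp A h (f n))"
proof -
  interpret C: complex_at A C n by fact
  interpret D: complex_at A D n by fact
  have h': "h \<in> Hom A (obj D n) X" and hd: "Comp A h (diff D (n + 1)) = Zero A (obj D (n + 1)) X"
    using h by (simp_all add: D.cocycle_def)
  have X: "X \<in> Ob A"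
    using h' by (rule C.Hom_in_Ob)
  have fk: "f k \<in> Hom A (obj C k) (obj D k)" for k
    using f by (simp add: is_chain_map_def)
  have comm: "Comp A (diff D k) (f k) = Comp A (f (k - 1)) (diff C k)" for k
    using f by (simp add: is_chain_map_def)
  have "homology_map_at (precomp A (diff D n) X) (precomp A (diff D (n + 1)) X)
      (precomp A (diff C n) X) (precomp A (f n) X) (hclass (precomp A (diff D n) X) h) =
      hclass (precomp A (diff C n) X) (ab_map (precomp A (f n) X) h)"
  proof (rule homology_map_at_hclass[OF D.Hom_seq[OF X] C.Hom_seq[OF X] C.precomp_closed[OF fk X]])
    fix k assume "k \<in> carrier (Hom_group A (obj D (n - 1)) X)"
    then have k: "k \<in> Hom A (obj D (n - 1)) X"
      by simp
    \<comment> \<open>The coboundary of \<open>k\<close> in \<open>Hom(D, X)\<close> becomes the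
      coboundary of this composite in \<open>Hom(C, X)\<close>.\<close>
    have kf: "Comp A k (f (n - 1)) \<in> Hom A (obj C (n - 1)) X"
      using fk k by (rule C.Comp_closed)
    have "ab_map (precomp A (f n) X) (ab_map (precomp A (diff D n) X) k) =
        ab_map (precomp A (diff C n) X) (Comp A k (f (n - 1)))"
      using C.ab_map_precomp[OF D.d_out k] C.ab_map_precomp[OF fk C.Comp_closed[OF D.d_out k]]
        C.ab_map_precomp[OF C.d_out kf] C.Comp_assoc[OF fk D.d_out k] C.Comp_assoc[OF C.d_out fk k]
        comm[of n]
      by simp
    then show "\<exists>z \<in> carrier (Hom_group A (obj C (n - 1)) X).
        ab_map (precomp A (f n) X) (ab_map (precomp A (diff D n) X) k) = ab_map (precomp A (diff C n) X) z"
      using kf by auto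
  qed (use h' hd in \<open>simp_all add: C.ab_map_precomp[OF D.d_in]\<close>)
  then show "HnHom_map A C D f n X (hclass (precomp A (diff D n) X) h) =
      hclass (precomp A (diff C n) X) (Comp A h (f n))"
    using X by (simp add: HnHom_map_def cohomology_map_def Hom_cpx_def C.ab_map_precomp[OF fk h'])
  have "Comp A (f n) (diff C (n + 1)) = Comp A (diff D (n + 1)) (f (n + 1))"
    using comm[of "n + 1"] by simp
  then have "Comp A (Comp A h (f n)) (diff C (n + 1)) = Zero A (obj C (n + 1)) X"
    using C.Comp_assoc[OF C.d_in fk h'] C.Comp_assoc[OF fk D.d_in h'] hd
      C.Comp_Zero_left[OF fk X] by simp
  then show "C.cocycle X (Comp A h (f n))"
    using C.Comp_closed[OF fk h'] by (simp add: C.cocycle_def)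
qed

section \<open>The isomorphism\<close>

text \<open>The transformation \<open>\<eta>\<close> is determined by its value \<open>x\<close> at the class of the cokernel \<open>c\<close> of
  \<open>d\<^sub>n\<^sub>+\<^sub>1\<close>, and the fibre of \<open>T c\<close> over \<open>x\<close> is a coset of the boundaries.\<close>

definition yoneda_class ::
  "('o, 'm, 'e) precat_scheme \<Rightarrow> int \<Rightarrow> ('o, 'm) cpx \<Rightarrow> ('o, 'm, 't monoid, 't ab_arrow) fctr
    \<Rightarrow> ('o \<Rightarrow> 'm set \<Rightarrow> 't) \<Rightarrow> 't set"
  where "yoneda_class A n C T \<eta> = (let c = cokernel_arrow A (diff C (n + 1)) in
    {y \<in> carrier (FOb T (obj C n)).
      ab_map (FArr T c) y = \<eta> (Cod A c) (hclass (precomp A (diff C n) (Cod A c)) c)})"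

locale yoneda_setting = right_exact_functor A T + complex_at A C n
  for A :: "('o, 'm, 'e) precat_scheme" and T :: "('o, 'm, 't monoid, 't ab_arrow) fctr" and C n
begin

abbreviation "NatT \<equiv> Nat_group A (HnHom A C n) T"
abbreviation "hcls y \<equiv> hclass (FArr T d_in) y"

lemma T_seq: "ab_seq (FArr T d_in) (FArr T d_out)
  (FOb T (obj C (n + 1))) (FOb T (obj C n)) (FOb T (obj C (n - 1)))"
proof
  show "FArr T d_in \<in> Hom Ab (FOb T (obj C (n + 1))) (FOb T (obj C n))"
    "FArr T d_out \<in> Hom Ab (FOb T (obj C n)) (FOb T (obj C (n - 1)))"
    using d_in d_out by (auto intro: FArr_T)
  fix y assume "y \<in> To (obj C (n + 1))"
  then show "Tm d_out (Tm d_in y) = \<one>\<^bsub>FOb T (obj C (n - 1))\<^esub>"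
    using Tm_Comp[OF d_in d_out, of y] cocycle_d_out Tm_Zero[OF obj_Ob obj_Ob]
    by (simp add: cocycle_def)
qed

sublocale TC: ab_seq "FArr T d_in" "FArr T d_out"
  "FOb T (obj C (n + 1))" "FOb T (obj C n)" "FOb T (obj C (n - 1))"
  by (rule T_seq)

sublocale Tc: group_hom "FOb T (obj C n)" "FOb T Q" "Tm c"
  using c by (rule group_hom_Tm)

lemma carrier_homology:
  "carrier (homology (map_cpx T C) n) =
    hcls ` {y \<in> To (obj C n). Tm d_out y = \<one>\<^bsub>FOb T (obj C (n - 1))\<^esub>}"
  using TC.carrier_homology_at by (simp add: homology_def map_cpx_def)

text \<open>By exactness, two elements with the same image under \<open>T c\<close> differ by a
  boundary. The family \<open>\<eta>\<close> enters only through its value at the class of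
  \<open>c\<close>, so products and vertical composites are treated by computing that one
  value.\<close>

lemma yoneda_class_eq:
  assumes y: "y \<in> To (obj C n)" and eq: "Tm c y = \<eta> Q (cls Q c)"
  shows "yoneda_class A n C T \<eta> = hcls y"
proof -
  have "Tm c z = Tm c y \<longleftrightarrow> z \<in> hcls y" if z: "z \<in> To (obj C n)" for z
  proof -
    let ?w = "z \<otimes>\<^bsub>FOb T (obj C n)\<^esub> inv\<^bsub>FOb T (obj C n)\<^esub> y"
    have "Tm c z = Tm c y \<longleftrightarrow> Tm c ?w = \<one>\<^bsub>FOb T Q\<^esub>"
      using y z Tc.H.inv_solve_right'[of "\<one>\<^bsub>FOb T Q\<^esub>" "Tm c z" "Tm c y"] by auto
    also have "\<dots> \<longleftrightarrow> ?w \<in> Tm d_in ` To (obj C (n + 1))"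
      using y z by (intro Tm_cokernel_eq_one_iff[OF is_cokernel_c c d_in]) simp
    also have "\<dots> \<longleftrightarrow> (\<exists>b \<in> To (obj C (n + 1)). ?w = Tm d_in b)"
      by blast
    also have "\<dots> \<longleftrightarrow> (\<exists>b \<in> To (obj C (n + 1)). z = Tm d_in b \<otimes>\<^bsub>FOb T (obj C n)\<^esub> y)"
      using y z TC.G.inv_solve_right' by (intro bex_cong) auto
    finally show ?thesis
      by (simp add: TC.mem_hclass)
  qed
  moreover have "hcls y \<subseteq> To (obj C n)"
    using y by (auto simp: TC.mem_hclass)
  ultimately show ?thesis
    using eq by (auto simp: yoneda_class_def Let_def)
qed

lemma Nat_hom: "\<eta> \<in> carrier NatT \<Longrightarrow> X \<in> Ob A \<Longrightarrow> \<eta> X \<in> hom (FOb (HnHom A C n) X) (FOb T X)"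
  by (simp add: Nat_group_def)

lemma Nat_closed: "\<eta> \<in> carrier NatT \<Longrightarrow> X \<in> Ob A \<Longrightarrow> cocycle X h \<Longrightarrow> \<eta> X (cls X h) \<in> To X"
  using Nat_hom cls_in_HnHom by (fastforce simp: hom_def)

lemma Nat_natural:
  assumes "\<eta> \<in> carrier NatT" and h: "cocycle X h" and f: "f \<in> Hom A X Y"
  shows "\<eta> Y (cls Y (Comp A f h)) = Tm f (\<eta> X (cls X h))"
proof -
  have "f \<in> Arr A" "Dom A f = X" "Cod A f = Y"
    using f by (auto simp: Hom_def)
  moreover have "cls X h \<in> carrier (FOb (HnHom A C n) X)"
    using h f by (intro cls_in_HnHom Hom_in_Ob)
  ultimately show ?thesis
    using assms(1) FArr_HnHom[OF h f] unfolding Nat_group_def by fastforce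
qed

lemma Nat_eqI:
  assumes \<eta>: "\<eta> \<in> carrier NatT" and \<theta>: "\<theta> \<in> carrier NatT" and eq: "\<eta> Q (cls Q c) = \<theta> Q (cls Q c)"
  shows "\<eta> = \<theta>"
proof (rule extensionalityI)
  show "\<eta> \<in> extensional (Ob A)" "\<theta> \<in> extensional (Ob A)"
    using \<eta> \<theta> by (auto simp: Nat_group_def)
  fix X assume X: "X \<in> Ob A"
  show "\<eta> X = \<theta> X"
  proof (rule extensionalityI)
    show "\<eta> X \<in> extensional (carrier (FOb (HnHom A C n) X))"
      "\<theta> X \<in> extensional (carrier (FOb (HnHom A C n) X))"
      using \<eta> \<theta> X by (auto simp: Nat_group_def)
    fix S assume "S \<in> carrier (FOb (HnHom A C n) X)"
    then obtain u where u: "u \<in> Hom A Q X" "S = cls X (Comp A u c)"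
      using HnHom_cases X by blast
    then show "\<eta> X S = \<theta> X S"
      using eq by (simp add: Nat_natural[OF _ cocycle_c] \<eta> \<theta>)
  qed
qed

text \<open>The class of \<open>d\<^sub>n\<close> itself is trivial, as \<open>d\<^sub>n\<close> is the coboundary of an identity.\<close>

lemma Nat_representative:
  assumes \<eta>: "\<eta> \<in> carrier NatT"
  obtains y where "y \<in> To (obj C n)" "Tm d_out y = \<one>\<^bsub>FOb T (obj C (n - 1))\<^esub>" "Tm c y = \<eta> Q (cls Q c)"
proof -
  have "\<eta> Q (cls Q c) \<in> Tm c ` To (obj C n)"
    using Nat_closed[OF \<eta> Q cocycle_c] by (simp only: Tm_cokernel_surj[OF is_cokernel_c c d_in])
  then obtain y where y: "y \<in> To (obj C n)" "Tm c y = \<eta> Q (cls Q c)"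
    by (elim imageE) simp
  obtain e where e: "e \<in> Hom A Q (obj C (n - 1))" "Comp A e c = d_out"
    using cocycle_factor[OF cocycle_d_out] by blast
  let ?X = "obj C (n - 1)"
  let ?z = "Zero A (obj C n) ?X"
  have z: "?z \<in> Hom A (obj C n) ?X" "cocycle ?X ?z"
    using Zero_closed obj_Ob Comp_Zero_left[OF d_in] by (simp_all add: cocycle_def)
  have "cls ?X d_out = cls ?X ?z"
    using cls_eq_iff[OF cocycle_d_out z(2)] Ide_closed[OF obj_Ob] Ide_Comp[OF d_out] Add_Zero[OF d_out]
    by metis
  moreover have "cls ?X ?z = \<one>\<^bsub>FOb (HnHom A C n) ?X\<^esub>"
    using ab_seq.one_homology_at[OF Hom_seq[OF obj_Ob]] by (simp add: FOb_HnHom)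
  \<comment> \<open>What is known of \<open>\<eta>\<close> is that it preserves products; it sends
    the neutral class to the neutral element because an idempotent of the group
    \<open>FOb T ?X\<close> is neutral.\<close>
  moreover have "\<eta> ?X (cls ?X ?z) \<otimes>\<^bsub>FOb T ?X\<^esub> \<eta> ?X (cls ?X ?z) = \<eta> ?X (cls ?X ?z)"
    using Nat_hom[OF \<eta> obj_Ob] cls_in_HnHom[OF obj_Ob z(2)] mult_HnHom[OF z(2) z(2)] Add_Zero[OF z(1)]
    by (fastforce simp: hom_def)
  ultimately have "\<eta> ?X (cls ?X d_out) = \<one>\<^bsub>FOb T ?X\<^esub>"
    using TC.g.H.r_cancel_one Nat_closed[OF \<eta> obj_Ob z(2)] by metis
  then have "Tm d_out y = \<one>\<^bsub>FOb T ?X\<^esub>"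
    using Nat_natural[OF \<eta> cocycle_c e(1)] Tm_Comp[OF c e(1) y(1)] y(2) e(2) by simp
  with y show thesis
    using that by blast
qed

text \<open>The class of \<open>u\<close> after \<open>c\<close> is sent to \<open>T u x\<close>,
  where \<open>x = T c y\<close>. Let \<open>e\<close> be the factor of \<open>d_out\<close> through
  \<open>c\<close>. The arrow \<open>u\<close> is unique up to adding some \<open>k\<close> after
  \<open>e\<close>; by additivity this changes the value by \<open>T k (T e x)\<close>, which is
  trivial as \<open>T e x = T d_out y\<close>.\<close>

lemma ex_Nat:
  assumes y: "y \<in> To (obj C n)" "Tm d_out y = \<one>\<^bsub>FOb T (obj C (n - 1))\<^esub>"
  obtains \<eta> where "\<eta> \<in> carrier NatT" "\<eta> Q (cls Q c) = Tm c y"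
proof -
  let ?F = "\<lambda>X. FOb (HnHom A C n) X"
  obtain e where e: "e \<in> Hom A Q (obj C (n - 1))" "Comp A e c = d_out"
    using cocycle_factor[OF cocycle_d_out] by blast
  define x where "x = Tm c y"
  have x: "x \<in> To Q"
    using y by (simp add: x_def)
  have ex: "Tm e x = \<one>\<^bsub>FOb T (obj C (n - 1))\<^esub>"
    using Tm_Comp[OF c e(1) y(1)] y(2) e(2) by (simp add: x_def)
  have well_def: "Tm u x = Tm v x"
    if u: "u \<in> Hom A Q X" and v: "v \<in> Hom A Q X" and eq: "cls X (Comp A u c) = cls X (Comp A v c)"
    for u v X
  proof -
    obtain k where k: "k \<in> Hom A (obj C (n - 1)) X"
      and uk: "Comp A u c = Add A (Comp A k d_out) (Comp A v c)"
      using eq cls_eq_iff cocycle_Comp_c u v by blast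
    have ke: "Comp A k e \<in> Hom A Q X"
      using e(1) k by (rule Comp_closed)
    interpret X: comm_group "FOb T X"
      using v by (intro FOb_T Hom_in_Ob)
    \<comment> \<open>The coboundary \<open>k d_out\<close> is \<open>k e c\<close>, so both sides
      end in the epimorphism \<open>c\<close>, which can be cancelled.\<close>
    have "Comp A u c = Comp A (Add A (Comp A k e) v) c"
      using Comp_Add_left[OF c ke v] Comp_assoc[OF c e(1) k] by (simp add: uk e(2))
    then have "u = Add A (Comp A k e) v"
      using u Add_closed[OF ke v] by (rule c_epi[rotated 2])
    then have "Tm u x = Tm k (Tm e x) \<otimes>\<^bsub>FOb T X\<^esub> Tm v x"
      using Tm_Add[OF ke v x] Tm_Comp[OF e(1) k x] by simp
    then show ?thesis
      using group_hom.hom_one[OF group_hom_Tm[OF k]] Tm_closed[OF v x] by (simp add: ex)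
  qed
  \<comment> \<open>Any arrow representing \<open>S\<close> may be chosen, by
    \<open>well_def\<close>.\<close>
  define \<eta> where "\<eta> = (\<lambda>X \<in> Ob A. \<lambda>S \<in> carrier (?F X).
    Tm (SOME u. u \<in> Hom A Q X \<and> S = cls X (Comp A u c)) x)"
  have \<eta>: "\<eta> X (cls X (Comp A u c)) = Tm u x" if u: "u \<in> Hom A Q X" for u X
  proof -
    define v where "v = (SOME v. v \<in> Hom A Q X \<and> cls X (Comp A u c) = cls X (Comp A v c))"
    have X: "X \<in> Ob A"
      using u by (rule Hom_in_Ob)
    have "v \<in> Hom A Q X \<and> cls X (Comp A u c) = cls X (Comp A v c)"
      unfolding v_def by (rule someI[where x = u]) (simp add: u)
    then have "Tm v x = Tm u x"
      using well_def[of v X u] u by simp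
    then show ?thesis
      using X cls_in_HnHom[OF X cocycle_Comp_c[OF u]] by (simp add: \<eta>_def v_def)
  qed
  have "\<eta> \<in> carrier NatT"
    unfolding Nat_group_def
  proof (simp, intro conjI ballI)
    show "\<eta> \<in> extensional (Ob A)"
      by (simp add: \<eta>_def)
    fix X assume X: "X \<in> Ob A"
    show "\<eta> X \<in> extensional (carrier (?F X))"
      using X by (simp add: \<eta>_def)
    show "\<eta> X \<in> hom (?F X) (FOb T X)"
    proof (rule homI)
      fix S assume "S \<in> carrier (?F X)"
      then obtain u where u: "u \<in> Hom A Q X" "S = cls X (Comp A u c)"
        using HnHom_cases X by blast
      then show "\<eta> X S \<in> To X"
        by (simp add: \<eta> Tm_closed[OF _ x])
      fix S' assume "S' \<in> carrier (?F X)"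
      then obtain v where v: "v \<in> Hom A Q X" "S' = cls X (Comp A v c)"
        using HnHom_cases X by blast
      have "S \<otimes>\<^bsub>?F X\<^esub> S' = cls X (Comp A (Add A u v) c)"
        using u v by (simp add: mult_HnHom cocycle_Comp_c Comp_Add_left[OF c])
      then show "\<eta> X (S \<otimes>\<^bsub>?F X\<^esub> S') = \<eta> X S \<otimes>\<^bsub>FOb T X\<^esub> \<eta> X S'"
        using u v by (simp add: \<eta> Add_closed Tm_Add[OF _ _ x])
    qed
  next
    fix f S assume f: "f \<in> Arr A" and S: "S \<in> carrier (?F (Dom A f))"
    have f': "f \<in> Hom A (Dom A f) (Cod A f)"
      using f by (simp add: Hom_def)
    obtain u where u: "u \<in> Hom A Q (Dom A f)" "S = cls (Dom A f) (Comp A u c)"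
      using HnHom_cases[OF Dom_closed[OF f] S] by blast
    have "ab_map (FArr (HnHom A C n) f) S = cls (Cod A f) (Comp A (Comp A f u) c)"
      using FArr_HnHom[OF cocycle_Comp_c[OF u(1)] f'] Comp_assoc[OF c u(1) f'] u(2) by simp
    then show "\<eta> (Cod A f) (ab_map (FArr (HnHom A C n) f) S) = Tm f (\<eta> (Dom A f) S)"
      using u by (simp add: \<eta> Comp_closed[OF u(1) f'] Tm_Comp[OF u(1) f' x])
  qed
  \<comment> \<open>The class of \<open>c\<close> is represented by the identity of
    \<open>Q\<close>.\<close>
  moreover have "\<eta> Q (cls Q c) = Tm c y"
    using \<eta>[OF Ide_closed[OF Q]] Ide_Comp[OF c] Tm_Ide[OF Q x] by (simp add: x_def)
  ultimately show thesis
    by (rule that)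
qed

lemma yoneda_class_iso: "yoneda_class A n C T \<in> iso NatT (homology (map_cpx T C) n)"
proof (rule isoI)
  show "yoneda_class A n C T \<in> hom NatT (homology (map_cpx T C) n)"
  proof (rule homI)
    fix \<eta> assume \<eta>: "\<eta> \<in> carrier NatT"
    obtain y where y: "y \<in> To (obj C n)" "Tm d_out y = \<one>\<^bsub>FOb T (obj C (n - 1))\<^esub>"
        "Tm c y = \<eta> Q (cls Q c)"
      using Nat_representative[OF \<eta>] .
    have \<eta>_eq: "yoneda_class A n C T \<eta> = hcls y"
      using yoneda_class_eq y by blast
    then show "yoneda_class A n C T \<eta> \<in> carrier (homology (map_cpx T C) n)"
      using y by (auto simp: carrier_homology)
    fix \<theta> assume \<theta>: "\<theta> \<in> carrier NatT"
    obtain z where z: "z \<in> To (obj C n)" "Tm d_out z = \<one>\<^bsub>FOb T (obj C (n - 1))\<^esub>"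
        "Tm c z = \<theta> Q (cls Q c)"
      using Nat_representative[OF \<theta>] .
    have \<theta>_eq: "yoneda_class A n C T \<theta> = hcls z"
      using yoneda_class_eq z by blast
    \<comment> \<open>\<open>NatT\<close> multiplies pointwise and \<open>T c\<close> is a
      homomorphism, so the product of \<open>y\<close> and \<open>z\<close> lies over the value of
      the product.\<close>
    have "(\<eta> \<otimes>\<^bsub>NatT\<^esub> \<theta>) Q (cls Q c) = Tm c (y \<otimes>\<^bsub>FOb T (obj C n)\<^esub> z)"
      using y z Q cls_in_HnHom[OF Q cocycle_c] by (simp add: Nat_group_def)
    then have "yoneda_class A n C T (\<eta> \<otimes>\<^bsub>NatT\<^esub> \<theta>) = hcls (y \<otimes>\<^bsub>FOb T (obj C n)\<^esub> z)"
      using y z by (intro yoneda_class_eq) auto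
    also have "\<dots> = hcls y \<otimes>\<^bsub>homology (map_cpx T C) n\<^esub> hcls z"
      using TC.mult_homology_at[OF y(1,2) z(1,2)] by (simp add: homology_def map_cpx_def)
    finally show "yoneda_class A n C T (\<eta> \<otimes>\<^bsub>NatT\<^esub> \<theta>) =
        yoneda_class A n C T \<eta> \<otimes>\<^bsub>homology (map_cpx T C) n\<^esub> yoneda_class A n C T \<theta>"
      by (simp only: \<eta>_eq \<theta>_eq)
  qed
  then have into: "yoneda_class A n C T \<eta> \<in> carrier (homology (map_cpx T C) n)"
    if "\<eta> \<in> carrier NatT" for \<eta>
    using that by (auto simp: hom_def)
  show "bij_betw (yoneda_class A n C T) (carrier NatT) (carrier (homology (map_cpx T C) n))"
  proof (rule bij_betw_imageI)
    show "inj_on (yoneda_class A n C T) (carrier NatT)"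
    proof (rule inj_onI)
      fix \<eta> \<theta> assume \<eta>: "\<eta> \<in> carrier NatT" and \<theta>: "\<theta> \<in> carrier NatT"
        and eq: "yoneda_class A n C T \<eta> = yoneda_class A n C T \<theta>"
      \<comment> \<open>A nonempty fibre determines the point below it; a representative of
        \<open>\<eta>\<close> shows that the common fibre is nonempty.\<close>
      obtain y where y: "y \<in> To (obj C n)" "Tm c y = \<eta> Q (cls Q c)"
        using Nat_representative[OF \<eta>] by blast
      then have "y \<in> yoneda_class A n C T \<theta>"
        unfolding eq[symmetric] by (simp add: yoneda_class_def Let_def)
      then have "Tm c y = \<theta> Q (cls Q c)"
        by (simp add: yoneda_class_def Let_def)
      with y(2) show "\<eta> = \<theta>"
        by (intro Nat_eqI \<eta> \<theta>) (rule trans[OF sym])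
    qed
    show "yoneda_class A n C T ` carrier NatT = carrier (homology (map_cpx T C) n)"
    proof (intro equalityI subsetI)
      fix S assume "S \<in> carrier (homology (map_cpx T C) n)"
      then obtain y where y: "y \<in> To (obj C n)" "Tm d_out y = \<one>\<^bsub>FOb T (obj C (n - 1))\<^esub>" "S = hcls y"
        by (auto simp: carrier_homology)
      obtain \<eta> where \<eta>: "\<eta> \<in> carrier NatT" "\<eta> Q (cls Q c) = Tm c y"
        using ex_Nat[OF y(1,2)] .
      then have "S = yoneda_class A n C T \<eta>"
        using yoneda_class_eq[OF y(1)] y(3) by simp
      then show "S \<in> yoneda_class A n C T ` carrier NatT"
        using \<eta>(1) by blast
    qed (use into in blast)
  qed
qed

end

section \<open>Naturality in the complex and in the functor\<close>

lemma yoneda_class_natural_complex: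
  assumes A: "abelian_category A" and C: "chain_complex A C" and D: "chain_complex A D"
    and f: "is_chain_map A C D f" and T: "right_exact A Ab T"
    and \<eta>: "\<eta> \<in> carrier (Nat_group A (HnHom A C n) T)"
  shows "yoneda_class A n D T (vcomp A (HnHom A D n) \<eta> (HnHom_map A C D f n)) =
    homology_map (map_cpx T C) (map_cpx T D) (\<lambda>k. FArr T (f k)) n (yoneda_class A n C T \<eta>)"
proof -
  interpret A: abelian_category A by fact
  interpret C: yoneda_setting A T C n by unfold_locales (fact T C)+
  interpret D: yoneda_setting A T D n by unfold_locales (fact T D)+
  have fk: "f k \<in> Hom A (obj C k) (obj D k)" for k
    using f by (simp add: is_chain_map_def)
  have comm: "Comp A (diff D k) (f k) = Comp A (f (k - 1)) (diff C k)" for k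
    using f by (simp add: is_chain_map_def)
  obtain y where y: "y \<in> C.To (obj C n)" "C.Tm C.d_out y = \<one>\<^bsub>FOb T (obj C (n - 1))\<^esub>"
      "C.Tm C.c y = \<eta> C.Q (C.cls C.Q C.c)"
    using C.Nat_representative[OF \<eta>] .
  have map: "HnHom_map A C D f n D.Q (D.cls D.Q D.c) = C.cls D.Q (Comp A D.c (f n))"
    and cf: "C.cocycle D.Q (Comp A D.c (f n))"
    using HnHom_map_cls[OF C.complex_at_axioms D.complex_at_axioms f D.cocycle_c] by simp_all
  \<comment> \<open>The arrow that \<open>f n\<close> induces between the two cokernels. Naturality
    of \<open>\<eta>\<close> along \<open>g\<close> places \<open>T (f n) y\<close> over the value
    of the composite transformation.\<close>
  obtain g where g: "g \<in> Hom A C.Q D.Q" "Comp A g C.c = Comp A D.c (f n)"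
    using C.cocycle_factor[OF cf] .
  have "vcomp A (HnHom A D n) \<eta> (HnHom_map A C D f n) D.Q (D.cls D.Q D.c) =
      \<eta> D.Q (C.cls D.Q (Comp A g C.c))"
    using D.Q D.cls_in_HnHom[OF D.Q D.cocycle_c] by (simp add: vcomp_def compose_def map g(2))
  also have "\<dots> = C.Tm g (C.Tm C.c y)"
    using C.Nat_natural[OF \<eta> C.cocycle_c g(1)] y(3) by simp
  also have "\<dots> = C.Tm D.c (C.Tm (f n) y)"
    using C.Tm_Comp[OF C.c g(1) y(1)] C.Tm_Comp[OF fk D.c y(1)] g(2) by simp
  finally have "yoneda_class A n D T (vcomp A (HnHom A D n) \<eta> (HnHom_map A C D f n)) =
      D.hcls (C.Tm (f n) y)"
    using C.Tm_closed[OF fk y(1)] by (intro D.yoneda_class_eq) simp_all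
  also have "\<dots> = homology_map_at (FArr T C.d_in) (FArr T C.d_out) (FArr T D.d_in) (FArr T (f n)) (C.hcls y)"
  proof (rule homology_map_at_hclass[OF C.T_seq D.T_seq C.FArr_T[OF fk] _ y(1,2), symmetric])
    fix z assume z: "z \<in> C.To (obj C (n + 1))"
    have "C.Tm (f n) (C.Tm C.d_in z) = C.Tm D.d_in (C.Tm (f (n + 1)) z)"
      using C.Tm_Comp[OF C.d_in fk z] C.Tm_Comp[OF fk D.d_in z] comm[of "n + 1"] by simp
    then show "\<exists>z' \<in> C.To (obj D (n + 1)). C.Tm (f n) (C.Tm C.d_in z) = C.Tm D.d_in z'"
      using C.Tm_closed[OF fk z] by blast
  qed
  also have "C.hcls y = yoneda_class A n C T \<eta>"
    using C.yoneda_class_eq y by blast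
  finally show ?thesis
    by (simp add: homology_map_def map_cpx_def)
qed

text \<open>Both sides are computed from the same \<open>y\<close>: naturality of
  \<open>\<tau>\<close> along \<open>c\<close> places \<open>\<tau> (obj C n) y\<close> over the
  value of the composite transformation.\<close>

lemma yoneda_class_natural_functor:
  assumes A: "abelian_category A" and C: "chain_complex A C"
    and T: "right_exact A Ab T" and T': "right_exact A Ab T'"
    and \<tau>: "\<tau> \<in> carrier (Nat_group A T T')" and \<eta>: "\<eta> \<in> carrier (Nat_group A (HnHom A C n) T)"
  shows "yoneda_class A n C T' (vcomp A (HnHom A C n) \<tau> \<eta>) =
    homology_map (map_cpx T C) (map_cpx T' C) (nat_cpx T T' \<tau> C) n (yoneda_class A n C T \<eta>)"
proof -
  interpret A: abelian_category A by fact
  interpret C: yoneda_setting A T C n by unfold_locales (fact T C)+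
  interpret C': yoneda_setting A T' C n by unfold_locales (fact T' C)+
  have \<tau>_arrow: "nat_cpx T T' \<tau> C n \<in> Hom Ab (FOb T (obj C n)) (FOb T' (obj C n))"
    using \<tau> C.obj_Ob C.FOb_T C'.FOb_T by (simp add: Hom_Ab_iff nat_cpx_def Nat_group_def)
  have \<tau>_natural: "\<tau> Y (C.Tm f x) = C'.Tm f (\<tau> X x)" if "f \<in> Hom A X Y" "x \<in> C.To X" for f x X Y
    using \<tau> that by (auto simp: Nat_group_def Hom_def)
  have \<tau>_closed: "\<tau> X x \<in> C'.To X" if "X \<in> Ob A" "x \<in> C.To X" for X x
    using \<tau> that by (auto simp: Nat_group_def hom_def)
  obtain y where y: "y \<in> C.To (obj C n)" "C.Tm C.d_out y = \<one>\<^bsub>FOb T (obj C (n - 1))\<^esub>"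
      "C.Tm C.c y = \<eta> C.Q (C.cls C.Q C.c)"
    using C.Nat_representative[OF \<eta>] .
  have "vcomp A (HnHom A C n) \<tau> \<eta> C.Q (C.cls C.Q C.c) = C'.Tm C.c (\<tau> (obj C n) y)"
    using C.Q C.cls_in_HnHom[OF C.Q C.cocycle_c] \<tau>_natural[OF C.c y(1)]
    by (simp add: vcomp_def compose_def y(3))
  then have "yoneda_class A n C T' (vcomp A (HnHom A C n) \<tau> \<eta>) = C'.hcls (\<tau> (obj C n) y)"
    using \<tau>_closed[OF C.obj_Ob y(1)] by (intro C'.yoneda_class_eq) simp_all
  also have "\<dots> = C'.hcls (ab_map (nat_cpx T T' \<tau> C n) y)"
    by (simp add: nat_cpx_def)
  also have "\<dots> = homology_map_at (FArr T C.d_in) (FArr T C.d_out) (FArr T' C.d_in)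
      (nat_cpx T T' \<tau> C n) (C.hcls y)"
  proof (rule homology_map_at_hclass[OF C.T_seq C'.T_seq \<tau>_arrow _ y(1,2), symmetric])
    fix z assume z: "z \<in> C.To (obj C (n + 1))"
    then show "\<exists>z' \<in> C'.To (obj C (n + 1)).
        ab_map (nat_cpx T T' \<tau> C n) (C.Tm C.d_in z) = C'.Tm C.d_in z'"
      using \<tau>_natural[OF C.d_in z] \<tau>_closed[OF C.obj_Ob z] by (auto simp: nat_cpx_def)
  qed
  also have "C.hcls y = yoneda_class A n C T \<eta>"
    using C.yoneda_class_eq y by blast
  finally show ?thesis
    by (simp add: homology_map_def map_cpx_def)
qed

text \<open>A single \<open>Y\<close> precedes the quantifiers over complexes and functors, so that
  naturality concerns one family. Both sides are covariant in the complex, since a chain map from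
  \<open>C\<close> to \<open>D\<close> acts on transformations by precomposition with a map from
  \<open>HnHom A D n\<close> to \<open>HnHom A C n\<close>.\<close>

theorem lemma1p1:
  fixes A :: "('o, 'm, 'e) precat_scheme" and n :: int
  assumes "abelian_category A"
  shows "\<exists>Y :: ('o, 'm) cpx \<Rightarrow> ('o, 'm, 't monoid, 't ab_arrow) fctr \<Rightarrow> ('o \<Rightarrow> 'm set \<Rightarrow> 't) \<Rightarrow> 't set.
    (\<forall>C T. chain_complex A C \<and> right_exact A Ab T \<longrightarrow>
      Y C T \<in> iso (Nat_group A (HnHom A C n) T) (homology (map_cpx T C) n)) \<and>
    (\<forall>C D f T. chain_complex A C \<and> chain_complex A D \<and> is_chain_map A C D f \<and> right_exact A Ab T \<longrightarrow>
      (\<forall>\<eta> \<in> carrier (Nat_group A (HnHom A C n) T).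
        Y D T (vcomp A (HnHom A D n) \<eta> (HnHom_map A C D f n)) =
        homology_map (map_cpx T C) (map_cpx T D) (\<lambda>k. FArr T (f k)) n (Y C T \<eta>))) \<and>
    (\<forall>C T T' \<tau>. chain_complex A C \<and> right_exact A Ab T \<and> right_exact A Ab T' \<and> \<tau> \<in> carrier (Nat_group A T T') \<longrightarrow>
      (\<forall>\<eta> \<in> carrier (Nat_group A (HnHom A C n) T).
        Y C T' (vcomp A (HnHom A C n) \<tau> \<eta>) =
        homology_map (map_cpx T C) (map_cpx T' C) (nat_cpx T T' \<tau> C) n (Y C T \<eta>)))"
proof (intro exI[of _ "yoneda_class A n"] conjI allI impI ballI; elim conjE)
  fix C :: "('o, 'm) cpx" and T :: "('o, 'm, 't monoid, 't ab_arrow) fctr"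
  assume "chain_complex A C" "right_exact A Ab T"
  then interpret yoneda_setting A T C n
    using assms
    by (simp add: yoneda_setting_def right_exact_functor_def right_exact_functor_axioms_def
        complex_at_def complex_at_axioms_def)
  show "yoneda_class A n C T \<in> iso (Nat_group A (HnHom A C n) T) (homology (map_cpx T C) n)"
    by (rule yoneda_class_iso)
qed (simp_all add: yoneda_class_natural_complex yoneda_class_natural_functor assms)

end
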